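(* Let $f\in L^2(S^2)$, $f\ne0$, be a complex-valued function satisfying $\|\widehat{f\sigma}\|_{L^4(\mathbb{R}^3)}=\mathcal{R}\|f\|_{L^2(S^2)}$ (an extremizer). Then $|f(-x)|=|f(x)|$ for almost every $x\in S^2$.
   Context: $S^2\subset\mathbb{R}^3$ is the unit sphere with surface measure $\sigma$, and $L^2(S^2)=L^2(S^2,\sigma)$. For $f\in L^2(S^2)$, $\widehat{f\sigma}(\xi)=\int_{S^2} e^{-ix\cdot\xi}f(x)\,d\sigma(x)$ for $\xi\in\mathbb{R}^3$. The constant $\mathcal{R}=\sup_{0\ne g\in L^2(S^2)}\|\widehat{g\sigma}\|_{L^4(\mathbb{R}^3)}/\|g\|_{L^2(S^2,\sigma)}$ is finite by the Tomas--Stein theorem. *)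

theory Defs
  imports "HOL-Analysis.Analysis"
begin

section \<open>Surface measure on the unit sphere\<close>

text \<open>
  Cone description of surface measure: the area of a Borel set \<open>A\<close> in the sphere is three times the
  Lebesgue measure of the open cone over \<open>A\<close>, i.e. of all \<open>r x\<close> with \<open>0 < r < 1\<close> and \<open>x \<in> A\<close>.  The factor
  is the dimension of the ambient space, from integrating \<open>r\<^sup>2\<close> over the unit interval in polar
  coordinates.  The underlying space is the sphere itself, with its Borel sets.  Lemmas
  \<open>emeasure_sphere_measure\<close> and \<open>emeasure_sphere_measure_space\<close> give this formula and the total
  mass \<open>4 * pi\<close>.
\<close>

definition sphere_measure :: "(real^3) measure"
  where "sphere_measure =
    scale_measure 3 (distr (restrict_space lborel (ball 0 1 - {0}))
                           (restrict_space borel (sphere 0 1)) (\<lambda>x. x /\<^sub>R norm x))"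

lemma space_sphere_measure [simp]: "space sphere_measure = sphere 0 1"
  by (simp add: sphere_measure_def space_scale_measure space_restrict_space)

lemma sets_sphere_measure [measurable_cong]:
  "sets sphere_measure = sets (restrict_space borel (sphere 0 1))"
  by (simp add: sphere_measure_def)

lemma radial_projection_measurable:
  "(\<lambda>x::real^3. x /\<^sub>R norm x) \<in>
     measurable (restrict_space lborel (ball 0 1 - {0})) (restrict_space borel (sphere 0 1))"
proof (rule measurable_restrict_space2)
  show "(\<lambda>x::real^3. x /\<^sub>R norm x) \<in> space (restrict_space lborel (ball 0 1 - {0})) \<rightarrow> sphere 0 1"
    by (auto simp: space_restrict_space)
  show "(\<lambda>x::real^3. x /\<^sub>R norm x) \<in> borel_measurable (restrict_space lborel (ball 0 1 - {0}))"
    by (rule measurable_restrict_space1) measurable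
qed

lemma emeasure_sphere_measure:
  fixes A :: "(real^3) set"
  assumes A: "A \<in> sets borel" "A \<subseteq> sphere 0 1"
  shows "emeasure sphere_measure A
           = 3 * emeasure lborel {r *\<^sub>R x | r x. 0 < r \<and> r < 1 \<and> x \<in> A}"
proof -
  let ?C = "{r *\<^sub>R x | r x. 0 < r \<and> r < 1 \<and> x \<in> A}"
  have pre: "(\<lambda>x. x /\<^sub>R norm x) -` A \<inter> (ball 0 1 - {0}) = ?C"
  proof (intro set_eqI iffI)
    fix y assume y: "y \<in> (\<lambda>x. x /\<^sub>R norm x) -` A \<inter> (ball 0 1 - {0})"
    then have "y = norm y *\<^sub>R (y /\<^sub>R norm y)" "0 < norm y" "norm y < 1" "y /\<^sub>R norm y \<in> A"
      by auto
    then show "y \<in> ?C" by blast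
  next
    fix y assume "y \<in> ?C"
    then obtain r x where rx: "y = r *\<^sub>R x" "0 < r" "r < 1" "x \<in> A" by blast
    with A have "norm x = 1" by auto
    with rx show "y \<in> (\<lambda>x. x /\<^sub>R norm x) -` A \<inter> (ball 0 1 - {0})" by auto
  qed
  have "A \<in> sets (restrict_space borel (sphere 0 1))"
    using A by (auto simp: sets_restrict_space_iff)
  then show ?thesis
    using radial_projection_measurable
    by (simp add: sphere_measure_def emeasure_distr space_restrict_space emeasure_restrict_space
                  pre[symmetric])
qed

lemma emeasure_sphere_measure_space: "emeasure sphere_measure (sphere 0 1) = ennreal (4 * pi)"
proof -
  have "{r *\<^sub>R x | r x. 0 < r \<and> r < 1 \<and> x \<in> sphere (0::real^3) 1} = ball 0 1 - {0}"
  proof (intro set_eqI iffI)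
    fix y :: "real^3" assume "y \<in> ball 0 1 - {0}"
    then have "y = norm y *\<^sub>R (y /\<^sub>R norm y)" "0 < norm y" "norm y < 1" "y /\<^sub>R norm y \<in> sphere 0 1"
      by auto
    then show "y \<in> {r *\<^sub>R x | r x. 0 < r \<and> r < 1 \<and> x \<in> sphere (0::real^3) 1}" by blast
  qed auto
  moreover have "emeasure lborel (ball (0::real^3) 1 - {0}) = ennreal (4 / 3 * pi)"
    using emeasure_ball[of 1 "0::real^3"]
    by (subst emeasure_Diff) (auto simp: unit_ball_vol_3)
  ultimately show ?thesis
    by (simp add: emeasure_sphere_measure ennreal_mult'[symmetric] flip: ennreal_numeral)
qed

section \<open>Lebesgue spaces\<close>

text \<open>The p-th root of an integral that may be infinite; intended for finite exponents \<open>p \<ge> 1\<close>.\<close>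

definition Lp_norm :: "real \<Rightarrow> 'a measure \<Rightarrow> ('a \<Rightarrow> 'b::real_normed_vector) \<Rightarrow> ennreal"
  where "Lp_norm p M f =
    (let I = (\<integral>\<^sup>+x. ennreal (norm (f x) powr p) \<partial>M)
     in if I = \<infinity> then \<infinity> else ennreal (enn2real I powr (1 / p)))"

text \<open>Elements are functions rather than classes modulo null sets, so that ``\<open>f\<close> is nonzero in the
  Lebesgue space'' reads \<open>\<not> (AE x in M. f x = 0)\<close>.\<close>

definition Lp_space :: "real \<Rightarrow> 'a measure \<Rightarrow> ('a \<Rightarrow> 'b::real_normed_vector) set"
  where "Lp_space p M = {f \<in> borel_measurable M. Lp_norm p M f < \<infinity>}"

section \<open>The extension operator and its sharp constant\<close>

definition sphere_fourier :: "(real^3 \<Rightarrow> complex) \<Rightarrow> real^3 \<Rightarrow> complex"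
  where "sphere_fourier f \<xi> =
    (LINT x|sphere_measure. exp (- \<i> * complex_of_real (x \<bullet> \<xi>)) * f x)"

definition sharp_const :: ennreal
  where "sharp_const =
    (SUP g \<in> {g \<in> Lp_space 2 sphere_measure. \<not> (AE x in sphere_measure. g x = 0)}.
       Lp_norm 4 lborel (sphere_fourier g) / Lp_norm 2 sphere_measure g)"

end

theory Submission
  imports Defs "HOL-Probability.Characteristic_Functions"
begin

text \<open>
  Write \<open>F\<close> for the transform \<open>sphere_fourier f\<close>.  Its squared modulus is the transform of a density on
  pairs of points of the sphere, superposing the characters of frequency \<open>a + c\<close>, and this density can
  be taken symmetric:
  \<open>(f a * cnj (f (- c)) + cnj (f (- a)) * f c) / 2\<close>.  By the Cauchy--Schwarz inequality its modulus is at most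
  \<open>u a * u c\<close>, where \<open>u\<close> is the quadratic mean of \<open>cmod f\<close> over antipodal pairs.  As \<open>u\<close> is even and real,
  \<open>u a * u c\<close> is the density that belongs to \<open>u\<close> in the same way.  Both \<open>f\<close> and \<open>u\<close> have the same \<open>L\<^sup>2\<close>
  norm.

  The fourth power of the \<open>L\<^sup>4\<close> norm of \<open>F\<close> is therefore the energy (squared \<open>L\<^sup>2\<close> norm) of a superposition
  of characters.  Inserting a Gaussian weight turns such an energy into a double integral of the
  density against a positive kernel.  Hence energies grow when a density is replaced by a majorant
  \<open>\<psi>\<close>, and the energy of the difference \<open>\<psi> - cmod \<phi>\<close> may even be added on the smaller side
  (\<open>energy_majorant\<close>).  If \<open>f\<close> is an extremizer, the energy belonging to \<open>u\<close> does not exceed that of \<open>f\<close>;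
  provided it is finite, the difference \<open>u a * u c - cmod (...)\<close> has zero energy.  A nonnegative density
  without energy has no mass (\<open>AE_eq_0_if_energy_eq_0\<close>), so equality holds in the Cauchy--Schwarz
  inequality for almost every pair, which says that
  \<open>cmod (f a) * cmod (f c) = cmod (f (- a)) * cmod (f (- c))\<close>.  Integrating over \<open>c\<close> gives the claim.

  Finiteness of the energy is the endpoint Tomas--Stein estimate for the sphere.  Its fourfold
  integral concentrates on quadruples of unit vectors with sum zero, and among these some
  pair and its complement are both far from antipodal (\<open>some_pair_not_antipodal\<close>).  There the singularity
  \<open>1 / norm x\<close> of the twofold convolution of surface measure is harmless
  (\<open>sphere_sphere_gauss_kernel_le\<close>), which rests on the zonal bound \<open>nn_integral_sphere_zonal_le\<close>.
\<close>

section \<open>Rotations, reflections and zones of the sphere\<close>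

lemma distr_lborel_orthogonal_transformation:
  fixes T :: "real^'n::{finite,wellorder} \<Rightarrow> real^'n::{finite,wellorder}"
  assumes T: "orthogonal_transformation T"
  shows "distr lborel borel T = lborel"
proof (rule lborel_eqI[symmetric])
  fix l u :: "real^'n::{finite,wellorder}"
  assume le: "\<And>b. b \<in> Basis \<Longrightarrow> l \<bullet> b \<le> u \<bullet> b"
  have lin: "linear T" and bij: "bij T"
    using T orthogonal_transformation_linear orthogonal_transformation_bij by blast+
  have [measurable]: "T \<in> borel \<rightarrow>\<^sub>M borel"
    using lin by (intro borel_measurable_continuous_onI linear_continuous_on) (simp add: linear_conv_bounded_linear)
  have T': "orthogonal_transformation (inv T)"
    using T by (rule orthogonal_transformation_inv)
  have vim: "T -` box l u = inv T ` box l u"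
    using bij by (simp add: bij_vimage_eq_inv_image)
  have meas: "box l u \<in> lmeasurable" by simp
  have "T -` box l u \<in> sets borel"
    using measurable_sets[OF \<open>T \<in> borel \<rightarrow>\<^sub>M borel\<close>, of "box l u"] by simp
  have "emeasure lborel (T -` box l u) = emeasure lebesgue (T -` box l u)"
    using \<open>T -` box l u \<in> sets borel\<close> by simp
  also have "\<dots> = ennreal (measure lebesgue (inv T ` box l u))"
    unfolding vim using measurable_orthogonal_image[OF T' meas]
    by (simp add: emeasure_eq_measure2 fmeasurableD2)
  also have "measure lebesgue (inv T ` box l u) = measure lebesgue (box l u)"
    by (rule measure_orthogonal_image[OF T' meas])
  also have "\<dots> = (\<Prod>b\<in>Basis. (u - l) \<bullet> b)"
    using le by (simp add: measure_lborel_box_eq)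
  finally show "emeasure (distr lborel borel T) (box l u) = (\<Prod>b\<in>Basis. (u - l) \<bullet> b)"
    by (simp add: emeasure_distr)
qed simp

text \<open>Integration over the sphere is integration of the degree-zero homogeneous extension over the
punctured ball; every computation with surface measure below goes through this formula.\<close>

lemma nn_integral_sphere_measure:
  assumes [measurable]: "g \<in> borel_measurable sphere_measure"
  shows "(\<integral>\<^sup>+x. g x \<partial>sphere_measure) =
    3 * (\<integral>\<^sup>+y. g (y /\<^sub>R norm y) * indicator (ball 0 1 - {0}) y \<partial>lborel)"
proof -
  have g: "g \<in> borel_measurable (restrict_space borel (sphere 0 1))"
    using assms measurable_cong_sets[OF sets_sphere_measure refl] by blast
  have "(\<integral>\<^sup>+x. g x \<partial>sphere_measure) =
      3 * (\<integral>\<^sup>+y. g (y /\<^sub>R norm y) \<partial>restrict_space lborel (ball 0 1 - {0}))"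
    unfolding sphere_measure_def
    using g radial_projection_measurable
    by (subst nn_integral_scale_measure) (simp_all add: nn_integral_distr)
  also have "(\<integral>\<^sup>+y. g (y /\<^sub>R norm y) \<partial>restrict_space lborel (ball 0 1 - {0})) =
      (\<integral>\<^sup>+y. g (y /\<^sub>R norm y) * indicator (ball 0 1 - {0}) y \<partial>lborel)"
    by (rule nn_integral_restrict_space) simp
  finally show ?thesis .
qed

lemma finite_measure_sphere_measure: "finite_measure sphere_measure"
  by (rule finite_measureI) (simp add: emeasure_sphere_measure_space)

lemma measurable_sphere_measureI [measurable (raw)]:
  "g \<in> measurable borel N \<Longrightarrow> g \<in> measurable sphere_measure N"
  by (simp add: measurable_cong_sets[OF sets_sphere_measure refl] measurable_restrict_space1)

lemma uminus_measurable_sphere_measure [measurable]: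
  "uminus \<in> measurable sphere_measure sphere_measure"
proof -
  have "uminus \<in> measurable (restrict_space borel (sphere (0::real^3) 1)) (restrict_space borel (sphere 0 1))"
    by (rule measurable_restrict_space3) auto
  then show ?thesis
    using measurable_cong_sets[OF sets_sphere_measure sets_sphere_measure] by blast
qed

lemma distr_sphere_measure_uminus: "distr sphere_measure sphere_measure uminus = sphere_measure"
proof (rule measure_eqI)
  fix A assume "A \<in> sets (distr sphere_measure sphere_measure uminus)"
  then have A[measurable]: "A \<in> sets sphere_measure" by simp
  have *: "(\<lambda>y. indicator A (y /\<^sub>R norm y) * indicator (ball 0 1 - {0}) y :: ennreal)
      \<in> borel_measurable lborel"
  proof -
    have A': "A \<in> sets borel"
      using A by (simp add: sets_sphere_measure sets_restrict_space_iff)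
    have "(\<lambda>y. indicator A (y /\<^sub>R norm y) * indicator (ball 0 1 - {0}) y :: ennreal)
        \<in> borel_measurable borel"
      using A' by (intro borel_measurable_times_ennreal borel_measurable_indicator
        measurable_compose[OF _ borel_measurable_indicator]) auto
    then show ?thesis by simp
  qed
  have "emeasure (distr sphere_measure sphere_measure uminus) A =
      (\<integral>\<^sup>+x. indicator A (- x) \<partial>sphere_measure)"
  proof -
    have "emeasure (distr sphere_measure sphere_measure uminus) A =
        (\<integral>\<^sup>+x. indicator A x \<partial>distr sphere_measure sphere_measure uminus)"
      by simp
    also have "\<dots> = (\<integral>\<^sup>+x. indicator A (- x) \<partial>sphere_measure)"
      by (rule nn_integral_distr) simp_all
    finally show ?thesis .
  qed
  also have "\<dots> = 3 * (\<integral>\<^sup>+y. indicator A (- (y /\<^sub>R norm y)) * indicator (ball 0 1 - {0}) y \<partial>lborel)"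
    by (subst nn_integral_sphere_measure) simp_all
  also have "(\<integral>\<^sup>+y. indicator A (- (y /\<^sub>R norm y)) * indicator (ball 0 1 - {0}) y \<partial>lborel) =
      (\<integral>\<^sup>+y. indicator A (y /\<^sub>R norm y) * indicator (ball 0 1 - {0}) y \<partial>distr lborel borel uminus)"
    using * by (subst nn_integral_distr) (auto intro!: nn_integral_cong split: split_indicator)
  also have "distr lborel borel uminus = (lborel :: (real^3) measure)"
    using orthogonal_transformation_neg[of "id::real^3\<Rightarrow>_"]
    by (intro distr_lborel_orthogonal_transformation) (simp add: orthogonal_transformation_id id_def)
  also have "3 * (\<integral>\<^sup>+y. indicator A (y /\<^sub>R norm y) * indicator (ball 0 1 - {0}) y \<partial>lborel) =
      (\<integral>\<^sup>+x. indicator A x \<partial>sphere_measure)"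
    by (subst nn_integral_sphere_measure) simp_all
  finally show "emeasure (distr sphere_measure sphere_measure uminus) A = emeasure sphere_measure A"
    by simp
qed simp

text \<open>On the line through \<open>p\<close> parallel to an axis, at squared distance \<open>q\<close> from it, the radial
projection has height \<open>t = (p + s) / sqrt ((p + s)\<^sup>2 + q)\<close> along the axis.  Since
\<open>1 - t\<^sup>2 = q / ((p + s)\<^sup>2 + q)\<close>, the derivative of \<open>t\<close> in \<open>s\<close> is the reciprocal of the weight
\<open>sqrt q / sqrt (1 - t\<^sup>2) ^ 3\<close>, and the condition of lying in the unit ball reads \<open>q < 1 - t\<^sup>2\<close>.\<close>

lemma zone_fibre_integral_le:
  fixes g :: "real \<Rightarrow> ennreal" and p q :: real
  assumes g[measurable]: "g \<in> borel_measurable borel" and q: "0 < q"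
  shows "(\<integral>\<^sup>+s. g ((p + s) / sqrt ((p + s)\<^sup>2 + q)) * indicator {s. (p + s)\<^sup>2 + q < 1} s
              * indicator {0..1} s \<partial>lborel)
      \<le> (\<integral>\<^sup>+t. g t * ennreal (sqrt q / sqrt (1 - t\<^sup>2) ^ 3) * indicator {t. q < 1 - t\<^sup>2} t
              * indicator {-1..1} t \<partial>lborel)" (is "?L \<le> ?R")
proof -
  define \<theta> where "\<theta> s = (p + s) / sqrt ((p + s)\<^sup>2 + q)" for s
  define \<theta>' where "\<theta>' s = q / sqrt ((p + s)\<^sup>2 + q) ^ 3" for s
  have pos: "0 < (p + s)\<^sup>2 + q" for s
    using q by (simp add: add_nonneg_pos)
  have der: "(\<theta> has_real_derivative \<theta>' s) (at s)" for s
  proof -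
    define w where "w = sqrt ((p + s)\<^sup>2 + q)"
    have w: "0 < w" "w * w = (p + s)\<^sup>2 + q"
      using pos[of s] by (simp_all add: w_def)
    have "(\<theta> has_real_derivative (1 * w - (p + s) * ((2 * (p + s)) * (inverse w / 2))) / (w * w)) (at s)"
      unfolding \<theta>_def w_def using pos[of s]
      by (auto intro!: derivative_eq_intros simp: power2_eq_square)
    also have "(1 * w - (p + s) * ((2 * (p + s)) * (inverse w / 2))) / (w * w) = (w * w - (p+s)\<^sup>2) / w ^ 3"
      using w(1) by (simp add: field_simps power2_eq_square power3_eq_cube)
    also have "\<dots> = \<theta>' s"
      by (simp add: w \<theta>'_def flip: w_def)
    finally show ?thesis .
  qed
  have one_minus: "1 - (\<theta> s)\<^sup>2 = q / ((p + s)\<^sup>2 + q)" for s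
    using pos[of s] by (simp add: \<theta>_def power_divide field_simps)
  have bound: "-1 \<le> \<theta> s \<and> \<theta> s \<le> 1" for s
  proof -
    have "0 \<le> 1 - (\<theta> s)\<^sup>2"
      unfolding one_minus using pos[of s] q by simp
    then show ?thesis
      using abs_square_le_1[of "\<theta> s"] by linarith
  qed
  define H where "H t = g t * ennreal (sqrt q / sqrt (1 - t\<^sup>2) ^ 3) * indicator {t. q < 1 - t\<^sup>2} t" for t
  have H[measurable]: "H \<in> borel_measurable borel"
    unfolding H_def by measurable
  have cont: "continuous_on {0..1} \<theta>'"
    unfolding \<theta>'_def using pos by (intro continuous_intros) (auto simp: less_imp_neq[symmetric] add_nonneg_eq_0_iff q less_imp_le)
  have "?L = (\<integral>\<^sup>+s. H (\<theta> s) * \<theta>' s * indicator {0..1} s \<partial>lborel)"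
  proof (rule nn_integral_cong)
    fix s
    define m where "m = (p + s)\<^sup>2 + q"
    have m: "0 < m" using pos by (simp add: m_def)
    have 1: "q < 1 - (\<theta> s)\<^sup>2 \<longleftrightarrow> m < 1"
      unfolding one_minus m_def[symmetric] using m q by (simp add: field_simps)
    have 2: "ennreal (sqrt q / sqrt (1 - (\<theta> s)\<^sup>2) ^ 3) * ennreal (\<theta>' s) = 1"
    proof -
      have "sqrt q / sqrt (1 - (\<theta> s)\<^sup>2) ^ 3 * \<theta>' s = 1"
        unfolding one_minus \<theta>'_def m_def[symmetric] real_sqrt_divide
        using m q by (simp add: field_simps power3_eq_cube)
      then show ?thesis
        using m q by (subst ennreal_mult[symmetric]) (auto simp: \<theta>'_def m_def one_minus)
    qed
    show "g ((p + s) / sqrt ((p + s)\<^sup>2 + q)) * indicator {s. (p + s)\<^sup>2 + q < 1} s * indicator {0..1} s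
        = H (\<theta> s) * \<theta>' s * indicator {0..1} s"
      using 1 2 by (auto simp: H_def mult.assoc \<theta>_def[symmetric] m_def split: split_indicator)
  qed
  also have "\<dots> = (\<integral>\<^sup>+t. H t * indicator {\<theta> 0..\<theta> 1} t \<partial>lborel)"
    by (rule nn_integral_substitution_aux[symmetric])
       (use der cont pos q in \<open>auto simp: \<theta>'_def\<close>)
  also have "\<dots> \<le> (\<integral>\<^sup>+t. H t * indicator {-1..1} t \<partial>lborel)"
  proof (rule nn_integral_mono)
    fix t
    show "H t * indicator {\<theta> 0..\<theta> 1} t \<le> H t * indicator {-1..1} t"
      using bound[of 0] bound[of 1] by (auto split: split_indicator)
  qed
  finally show ?thesis
    by (simp add: H_def)
qed

lemma emeasure_truncated_cylinder_le:
  assumes "0 \<le> \<rho>"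
  shows "emeasure lborel {y::real^3. \<bar>y$1\<bar> \<le> 2 \<and> (y$2)\<^sup>2 + (y$3)\<^sup>2 < \<rho>\<^sup>2} \<le> ennreal (16 * \<rho>\<^sup>2)"
proof -
  let ?a = "vector [-2, -\<rho>, -\<rho>] :: real^3" and ?b = "vector [2, \<rho>, \<rho>] :: real^3"
  have "{y::real^3. \<bar>y$1\<bar> \<le> 2 \<and> (y$2)\<^sup>2 + (y$3)\<^sup>2 < \<rho>\<^sup>2} \<subseteq> cbox ?a ?b"
  proof clarify
    fix y :: "real^3" assume y: "\<bar>y$1\<bar> \<le> 2" "(y$2)\<^sup>2 + (y$3)\<^sup>2 < \<rho>\<^sup>2"
    have "(y$2)\<^sup>2 \<le> \<rho>\<^sup>2" "(y$3)\<^sup>2 \<le> \<rho>\<^sup>2"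
      using y(2) zero_le_power2[of "y$2"] zero_le_power2[of "y$3"] by linarith+
    then have "\<bar>y$2\<bar> \<le> \<rho>" "\<bar>y$3\<bar> \<le> \<rho>"
      using assms abs_le_square_iff[of "y$2" \<rho>] abs_le_square_iff[of "y$3" \<rho>] by auto
    with y(1) show "y \<in> cbox ?a ?b"
      by (auto simp: mem_box_cart forall_3 vector_3)
  qed
  then have "emeasure lborel {y::real^3. \<bar>y$1\<bar> \<le> 2 \<and> (y$2)\<^sup>2 + (y$3)\<^sup>2 < \<rho>\<^sup>2} \<le> emeasure lborel (cbox ?a ?b)"
    by (intro emeasure_mono) auto
  also have "\<dots> = ennreal (measure lborel (cbox ?a ?b))"
    using emeasure_lborel_cbox_finite[of ?a ?b] by (intro emeasure_eq_ennreal_measure) auto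
  also have "measure lborel (cbox ?a ?b) = 16 * \<rho>\<^sup>2"
  proof -
    have "cbox ?a ?b \<noteq> {}"
      using assms by (simp add: interval_ne_empty_cart forall_3 vector_3)
    then show ?thesis
      unfolding content_cbox_cart[OF \<open>cbox ?a ?b \<noteq> {}\<close>] UNIV_3 by (simp add: vector_3 power2_eq_square)
  qed
  finally show ?thesis .
qed

text \<open>Archimedes' theorem on zones, up to the value of the constant: the projection of surface measure to
an axis has bounded density.  After rotating \<open>e\<close> to the first axis, averaging the integral over the
ball over translations by \<open>s\<close> in the unit interval along that axis introduces a one-dimensional
integral on each line parallel to the axis, to which the substitution above applies.  Exchanging the
integrals, the weight at height \<open>t\<close> is at most \<open>1 / \<rho>\<^sup>2\<close> with \<open>\<rho>\<^sup>2 = 1 - t\<^sup>2\<close>, on a cylinder of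
radius \<open>\<rho>\<close> and length \<open>4\<close>, so the singularity at the poles cancels.  The constant is the cone factor
\<open>3\<close> times the volume \<open>16 \<rho>\<^sup>2\<close> of a box around the cylinder.\<close>

lemma nn_integral_sphere_zonal_le:
  fixes g :: "real \<Rightarrow> ennreal"
  assumes g[measurable]: "g \<in> borel_measurable borel" and e: "norm e = 1"
  shows "(\<integral>\<^sup>+x. g (e \<bullet> x) \<partial>sphere_measure) \<le> 48 * (\<integral>\<^sup>+t. g t * indicator {-1..1} t \<partial>lborel)"
proof -
  define e1 :: "real^3" where "e1 = axis 1 1"
  have "norm e1 = 1" by (simp add: e1_def norm_axis_1)
  then obtain T where T: "orthogonal_transformation T" "T e1 = e"
    using e orthogonal_transformation_exists_1 by metis
  define Q :: "real^3 \<Rightarrow> real" where "Q y = (y$2)\<^sup>2 + (y$3)\<^sup>2" for y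
  have [measurable]: "Q \<in> borel_measurable borel"
    unfolding Q_def by (intro borel_measurable_continuous_onI continuous_intros)
  have Q_nonneg: "0 \<le> Q y" for y by (simp add: Q_def)
  define A :: "(real^3) set" where "A = {y. \<bar>y$1\<bar> \<le> 2}"
  have [measurable]: "A \<in> sets borel"
    unfolding A_def by (intro borel_closed closed_Collect_le continuous_intros)
  define G :: "real^3 \<Rightarrow> ennreal" where "G y = g (y$1 / norm y) * indicator (ball 0 1 - {0}) y" for y
  have [measurable]: "ball 0 1 - {0} \<in> sets (borel :: (real^3) measure)" by simp
  have G[measurable]: "G \<in> borel_measurable borel"
    unfolding G_def by measurable
  define G' :: "real^3 \<Rightarrow> ennreal" where "G' y = g (e \<bullet> y / norm y) * indicator (ball 0 1 - {0}) y" for y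
  have G'[measurable]: "G' \<in> borel_measurable borel"
    unfolding G'_def by measurable
  have T_meas: "T \<in> borel \<rightarrow>\<^sub>M borel"
    using orthogonal_transformation_linear[OF T(1)]
    by (intro borel_measurable_continuous_onI linear_continuous_on) (simp add: linear_conv_bounded_linear)
  have "(\<integral>\<^sup>+x. g (e \<bullet> x) \<partial>sphere_measure) = 3 * (\<integral>\<^sup>+y. G' y \<partial>lborel)"
    unfolding G'_def by (subst nn_integral_sphere_measure) (simp_all add: divide_inverse mult.commute)
  also have "(\<integral>\<^sup>+y. G' y \<partial>lborel) = (\<integral>\<^sup>+y. G' y \<partial>distr lborel borel T)"
    by (simp add: distr_lborel_orthogonal_transformation[OF T(1)])
  also have "\<dots> = (\<integral>\<^sup>+y. G' (T y) \<partial>lborel)"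
    using T_meas by (subst nn_integral_distr) simp_all
  also have "\<dots> = (\<integral>\<^sup>+y. G y \<partial>lborel)"
  proof (rule nn_integral_cong)
    fix y
    have "e \<bullet> T y = e1 \<bullet> y"
      using T by (metis orthogonal_transformation_def)
    also have "\<dots> = y $ 1" by (simp add: e1_def inner_axis')
    finally have "e \<bullet> T y = y $ 1" .
    moreover have "norm (T y) = norm y" using T(1) by (rule orthogonal_transformation_norm)
    moreover have "T y = 0 \<longleftrightarrow> y = 0" using \<open>norm (T y) = norm y\<close> by (metis norm_eq_zero)
    ultimately show "G' (T y) = G y"
      by (auto simp: G_def G'_def split: split_indicator)
  qed
  also have "\<dots> = (\<integral>\<^sup>+s. (\<integral>\<^sup>+y. G y \<partial>lborel) * indicator {0..1::real} s \<partial>lborel)"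
    by (simp add: nn_integral_cmult_indicator)
  also have "\<dots> = (\<integral>\<^sup>+s. (\<integral>\<^sup>+y. G (s *\<^sub>R e1 + y) * indicator {0..1::real} s \<partial>lborel) \<partial>lborel)"
  proof (rule nn_integral_cong)
    fix s :: real
    have "(\<integral>\<^sup>+y. G y \<partial>lborel) = (\<integral>\<^sup>+y. G y \<partial>distr lborel borel ((+) (s *\<^sub>R e1)))"
      by (simp add: lborel_distr_plus)
    also have "\<dots> = (\<integral>\<^sup>+y. G (s *\<^sub>R e1 + y) \<partial>lborel)"
      by (subst nn_integral_distr) simp_all
    finally show "(\<integral>\<^sup>+y. G y \<partial>lborel) * indicator {0..1::real} s =
        (\<integral>\<^sup>+y. G (s *\<^sub>R e1 + y) * indicator {0..1::real} s \<partial>lborel)"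
      by (simp add: nn_integral_multc)
  qed
  also have "\<dots> = (\<integral>\<^sup>+y. (\<integral>\<^sup>+s. G (s *\<^sub>R e1 + y) * indicator {0..1::real} s \<partial>lborel) \<partial>lborel)"
    by (rule lborel_pair.Fubini') measurable
  also have "\<dots> \<le> (\<integral>\<^sup>+y. (\<integral>\<^sup>+t. indicator A y *
      (g t * ennreal (sqrt (Q y) / sqrt (1 - t\<^sup>2) ^ 3)
        * indicator {t. Q y < 1 - t\<^sup>2} t * indicator {-1..1} t) \<partial>lborel) \<partial>lborel)"
  proof (rule nn_integral_mono_AE)
    have "AE y in lebesgue. y \<notin> {y::real^3. y$2 = 0}"
      using negligible_standard_hyperplane_cart[of "2::3"]
      by (intro AE_not_in) (simp add: negligible_iff_null_sets)
    then have "AE y::real^3 in lborel. y $ 2 \<noteq> 0"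
      by (simp add: AE_completion_iff)
    then show "AE y in lborel. (\<integral>\<^sup>+s. G (s *\<^sub>R e1 + y) * indicator {0..1::real} s \<partial>lborel) \<le>
      (\<integral>\<^sup>+t. indicator A y *
      (g t * ennreal (sqrt (Q y) / sqrt (1 - t\<^sup>2) ^ 3)
        * indicator {t. Q y < 1 - t\<^sup>2} t * indicator {-1..1} t) \<partial>lborel)"
    proof eventually_elim
      fix y :: "real^3" assume y: "y $ 2 \<noteq> 0"
      define q where "q = Q y"
      have q: "0 < q" using y by (simp add: q_def Q_def add_pos_nonneg)
      have nrm: "norm (s *\<^sub>R e1 + y) = sqrt ((y$1 + s)\<^sup>2 + q)" for s
      proof -
        have "(s *\<^sub>R e1 + y) \<bullet> (s *\<^sub>R e1 + y) = (y$1 + s)\<^sup>2 + q"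
          by (simp add: inner_vec_def sum_3 e1_def axis_def q_def Q_def power2_eq_square add.commute)
        then show ?thesis by (simp add: norm_eq_sqrt_inner)
      qed
      have one: "(s *\<^sub>R e1 + y) $ 1 = y$1 + s" for s
        by (simp add: e1_def axis_def)
      have "(\<integral>\<^sup>+s. G (s *\<^sub>R e1 + y) * indicator {0..1::real} s \<partial>lborel)
        \<le> (\<integral>\<^sup>+s. indicator A y * (g ((y$1 + s) / sqrt ((y$1 + s)\<^sup>2 + q)) *
              indicator {s. (y$1 + s)\<^sup>2 + q < 1} s * indicator {0..1} s) \<partial>lborel)"
      proof (rule nn_integral_mono)
        fix s :: real
        have y_bound: "\<bar>y$1\<bar> \<le> 2" if "(y$1 + s)\<^sup>2 + q < 1" "0 \<le> s" "s \<le> 1"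
        proof -
          have "(y$1 + s)\<^sup>2 \<le> 1" using that(1) q by linarith
          then have "\<bar>y$1 + s\<bar> \<le> 1" by (simp add: abs_square_le_1)
          with that show ?thesis by linarith
        qed
        have ball: "(y$1 + s)\<^sup>2 + q < 1" if "s *\<^sub>R e1 + y \<in> ball 0 1"
          using that unfolding mem_ball_0 nrm by simp
        show "G (s *\<^sub>R e1 + y) * indicator {0..1::real} s \<le>
          indicator A y * (g ((y$1 + s) / sqrt ((y$1 + s)\<^sup>2 + q)) *
              indicator {s. (y$1 + s)\<^sup>2 + q < 1} s * indicator {0..1} s)"
        proof (cases "s *\<^sub>R e1 + y \<in> ball 0 1 - {0} \<and> s \<in> {0..1}")
          case True
          then have m: "(y$1 + s)\<^sup>2 + q < 1" using ball by blast
          moreover have "0 \<le> s" "s \<le> 1" using True by simp_all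
          ultimately have "y \<in> A" unfolding A_def mem_Collect_eq by (rule y_bound)
          with m have "indicator {s. (y$1 + s)\<^sup>2 + q < 1} s = (1::ennreal)"
              "indicator A y = (1::ennreal)"
            by (simp_all only: indicator_eq_1_iff mem_Collect_eq)
          moreover have "G (s *\<^sub>R e1 + y) = g ((y$1 + s) / sqrt ((y$1 + s)\<^sup>2 + q))"
            using True unfolding G_def one nrm by (simp only: indicator_simps mult_1_right)
          ultimately show ?thesis
            by (simp only: mult_1_right mult_1_left order_refl)
        next
          case False
          then have "G (s *\<^sub>R e1 + y) * indicator {0..1::real} s = 0"
            unfolding G_def mult_eq_0_iff indicator_eq_0_iff by blast
          then show ?thesis by (simp only: zero_le)
        qed
      qed
      also have "\<dots> = indicator A y * (\<integral>\<^sup>+s. (g ((y$1 + s) / sqrt ((y$1 + s)\<^sup>2 + q)) *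
              indicator {s. (y$1 + s)\<^sup>2 + q < 1} s * indicator {0..1} s) \<partial>lborel)"
        by (rule nn_integral_cmult) measurable
      also have "\<dots> \<le> indicator A y *
        (\<integral>\<^sup>+t. (g t * ennreal (sqrt q / sqrt (1 - t\<^sup>2) ^ 3)
          * indicator {t. q < 1 - t\<^sup>2} t * indicator {-1..1} t) \<partial>lborel)"
        by (intro mult_left_mono zone_fibre_integral_le g q) simp
      also have "\<dots> = (\<integral>\<^sup>+t. indicator A y * (g t * ennreal (sqrt q / sqrt (1 - t\<^sup>2) ^ 3)
          * indicator {t. q < 1 - t\<^sup>2} t * indicator {-1..1} t) \<partial>lborel)"
        by (rule nn_integral_cmult[symmetric]) measurable
      finally show "(\<integral>\<^sup>+s. G (s *\<^sub>R e1 + y) * indicator {0..1::real} s \<partial>lborel) \<le>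
        (\<integral>\<^sup>+t. indicator A y *
        (g t * ennreal (sqrt (Q y) / sqrt (1 - t\<^sup>2) ^ 3)
          * indicator {t. Q y < 1 - t\<^sup>2} t * indicator {-1..1} t) \<partial>lborel)"
        by (simp add: q_def)
    qed
  qed
  also have "\<dots> = (\<integral>\<^sup>+t. (\<integral>\<^sup>+y. indicator A y *
      (g t * ennreal (sqrt (Q y) / sqrt (1 - t\<^sup>2) ^ 3)
        * indicator {t. Q y < 1 - t\<^sup>2} t * indicator {-1..1} t) \<partial>lborel) \<partial>lborel)"
  proof (rule lborel_pair.Fubini')
    show "(\<lambda>(t::real, y::real^3). indicator A y *
      (g t * ennreal (sqrt (Q y) / sqrt (1 - t\<^sup>2) ^ 3)
        * indicator {t. Q y < 1 - t\<^sup>2} t * indicator {-1..1} t))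
      \<in> borel_measurable (lborel \<Otimes>\<^sub>M lborel)"
      unfolding case_prod_beta indicator_def by measurable
  qed
  also have "\<dots> \<le> (\<integral>\<^sup>+t. 16 * (g t * indicator {-1..1} t) \<partial>lborel)"
  proof (rule nn_integral_mono)
    fix t :: real
    show "(\<integral>\<^sup>+y. indicator A y *
      (g t * ennreal (sqrt (Q y) / sqrt (1 - t\<^sup>2) ^ 3)
        * indicator {t. Q y < 1 - t\<^sup>2} t * indicator {-1..1} t) \<partial>lborel)
      \<le> 16 * (g t * indicator {-1..1} t)"
    proof (cases "t\<^sup>2 < 1")
      case False
      have "indicator {t. Q y < 1 - t\<^sup>2} t = (0::ennreal)" for y :: "real^3"
      proof -
        have "\<not> Q y < 1 - t\<^sup>2"
          using False Q_nonneg[of y] by linarith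
        then show ?thesis by simp
      qed
      then show ?thesis by simp
    next
      case True
      define \<rho> where "\<rho> = sqrt (1 - t\<^sup>2)"
      have \<rho>: "0 < \<rho>" "\<rho>\<^sup>2 = 1 - t\<^sup>2" using True by (simp_all add: \<rho>_def)
      let ?C = "{y \<in> A. Q y < \<rho>\<^sup>2}"
      have C: "?C = {y. \<bar>y$1\<bar> \<le> 2 \<and> (y$2)\<^sup>2 + (y$3)\<^sup>2 < \<rho>\<^sup>2}"
        by (simp add: A_def Q_def)
      have "(\<integral>\<^sup>+y. indicator A y *
        (g t * ennreal (sqrt (Q y) / sqrt (1 - t\<^sup>2) ^ 3)
          * indicator {t. Q y < 1 - t\<^sup>2} t * indicator {-1..1} t) \<partial>lborel)
        \<le> (\<integral>\<^sup>+y. (g t * indicator {-1..1} t * ennreal (1 / \<rho>\<^sup>2)) * indicator ?C y \<partial>lborel)"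
      proof (rule nn_integral_mono)
        fix y :: "real^3"
        have "ennreal (sqrt (Q y) / sqrt (1 - t\<^sup>2) ^ 3) \<le> ennreal (1 / \<rho>\<^sup>2)"
          if "Q y < \<rho>\<^sup>2"
        proof (rule ennreal_leI)
          have "sqrt (Q y) \<le> sqrt (\<rho>\<^sup>2)"
            using that by (intro real_sqrt_le_mono) simp
          then have "sqrt (Q y) / \<rho> ^ 3 \<le> \<rho> / \<rho> ^ 3"
            using \<rho>(1) by (intro divide_right_mono) auto
          also have "\<dots> = 1 / \<rho>\<^sup>2"
            using \<rho>(1) by (simp add: power2_eq_square power3_eq_cube)
          finally show "sqrt (Q y) / sqrt (1 - t\<^sup>2) ^ 3 \<le> 1 / \<rho>\<^sup>2"
            by (simp add: \<rho>_def)
        qed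
        then show "indicator A y *
          (g t * ennreal (sqrt (Q y) / sqrt (1 - t\<^sup>2) ^ 3)
            * indicator {t. Q y < 1 - t\<^sup>2} t * indicator {-1..1} t)
          \<le> (g t * indicator {-1..1} t * ennreal (1 / \<rho>\<^sup>2)) * indicator ?C y"
          by (auto simp: \<rho>(2) intro!: mult_left_mono split: split_indicator)
      qed
      also have "\<dots> = (g t * indicator {-1..1} t * ennreal (1 / \<rho>\<^sup>2)) * emeasure lborel ?C"
        by (rule nn_integral_cmult_indicator) simp
      also have "\<dots> \<le> (g t * indicator {-1..1} t * ennreal (1 / \<rho>\<^sup>2)) * ennreal (16 * \<rho>\<^sup>2)"
        using \<rho>(1) emeasure_truncated_cylinder_le[of \<rho>] by (intro mult_left_mono) (auto simp: C)
      also have "\<dots> = (g t * indicator {-1..1} t) * ennreal (1 / \<rho>\<^sup>2 * (16 * \<rho>\<^sup>2))"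
        by (subst ennreal_mult) (auto simp: mult.assoc)
      also have "1 / \<rho>\<^sup>2 * (16 * \<rho>\<^sup>2) = 16"
        using \<rho>(1) by simp
      finally show ?thesis
        by (simp add: mult.commute)
    qed
  qed
  also have "\<dots> = 16 * (\<integral>\<^sup>+t. g t * indicator {-1..1} t \<partial>lborel)"
    by (rule nn_integral_cmult) measurable
  finally have "(\<integral>\<^sup>+x. g (e \<bullet> x) \<partial>sphere_measure) \<le> 3 * (16 * (\<integral>\<^sup>+t. g t * indicator {-1..1} t \<partial>lborel))"
    by (simp add: mult_left_mono)
  then show ?thesis
    by (simp add: mult.assoc[symmetric])
qed

section \<open>Gaussian regularisation of the Fourier integral\<close>

text \<open>The weight increases to the constant \<open>1\<close> as \<open>r\<close> grows, and \<open>gauss_kernel r\<close> is its Fourier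
transform.  The comparison of energies rests on the strict positivity of the kernel.\<close>

definition gauss_weight :: "real \<Rightarrow> 'a::euclidean_space \<Rightarrow> real"
  where "gauss_weight r \<xi> = exp (- (norm \<xi> / r)\<^sup>2 / 2)"

definition gauss_kernel :: "real \<Rightarrow> 'a::euclidean_space \<Rightarrow> real"
  where "gauss_kernel r x = (sqrt (2 * pi) * r) ^ DIM('a) * exp (- (r * norm x)\<^sup>2 / 2)"

lemma gauss_weight_pos: "0 < gauss_weight r \<xi>"
  by (simp add: gauss_weight_def)

lemma gauss_kernel_pos: "0 < r \<Longrightarrow> 0 < gauss_kernel r x"
  by (simp add: gauss_kernel_def)

lemma measurable_gauss_weight [measurable]: "gauss_weight r \<in> borel_measurable borel"
  unfolding gauss_weight_def by measurable

lemma measurable_gauss_kernel [measurable]: "gauss_kernel r \<in> borel_measurable borel"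
  unfolding gauss_kernel_def by measurable

lemma gauss_fourier_real:
  assumes r: "0 < r"
  shows "has_bochner_integral lborel
      (\<lambda>t. exp (- \<i> * complex_of_real (x * t)) * complex_of_real (exp (- (t / r)\<^sup>2 / 2)))
      (complex_of_real (sqrt (2 * pi) * r * exp (- (r * x)\<^sup>2 / 2)))"
proof -
  have int: "integrable lborel (\<lambda>t. std_normal_density t *\<^sub>R iexp (- (r * x) * t))"
    by (rule Bochner_Integration.integrable_bound[OF integrable_normal_density[where \<mu>=0 and \<sigma>=1]]) auto
  have "char std_normal_distribution (- (r * x)) = (\<integral>t. std_normal_density t *\<^sub>R iexp (- (r * x) * t) \<partial>lborel)"
    unfolding char_def by (subst integral_density) (auto simp: normal_density_nonneg)
  then have "has_bochner_integral lborel (\<lambda>t. std_normal_density t *\<^sub>R iexp (- (r * x) * t))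
      (complex_of_real (exp (- ((r * x)\<^sup>2) / 2)))"
    using int by (simp add: has_bochner_integral_iff char_std_normal_distribution)
  then have "has_bochner_integral lborel (\<lambda>t. std_normal_density (0 + 1/r * t) *\<^sub>R iexp (- (r * x) * (0 + 1/r * t)))
      (complex_of_real (exp (- ((r * x)\<^sup>2) / 2)) /\<^sub>R \<bar>1/r\<bar>)"
    using r by (subst (asm) lborel_has_bochner_integral_real_affine_iff[where c="1/r" and t=0]) simp_all
  then have "has_bochner_integral lborel (\<lambda>t. complex_of_real (sqrt (2*pi)) * (std_normal_density (0 + 1/r * t) *\<^sub>R iexp (- (r * x) * (0 + 1/r * t))))
      (complex_of_real (sqrt (2*pi)) * (complex_of_real (exp (- ((r * x)\<^sup>2) / 2)) /\<^sub>R \<bar>1/r\<bar>))"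
    by (rule has_bochner_integral_mult_right) 
  also have "(\<lambda>t. complex_of_real (sqrt (2*pi)) * (std_normal_density (0 + 1/r * t) *\<^sub>R iexp (- (r * x) * (0 + 1/r * t)))) =
     (\<lambda>t. exp (- \<i> * complex_of_real (x * t)) * complex_of_real (exp (- (t / r)\<^sup>2 / 2)))"
    using r by (auto simp: fun_eq_iff std_normal_density_def scaleR_conv_of_real field_simps)
  also have "(complex_of_real (sqrt (2*pi)) * (complex_of_real (exp (- ((r * x)\<^sup>2) / 2)) /\<^sub>R \<bar>1/r\<bar>)) =
     (complex_of_real (sqrt (2 * pi) * r * exp (- (r * x)\<^sup>2 / 2)))"
    using r by (simp add: scaleR_conv_of_real field_simps)
  finally show ?thesis .
qed

lemma has_bochner_integral_lborel_prod:
  fixes f :: "'a::euclidean_space \<Rightarrow> real \<Rightarrow> complex"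
  assumes f: "\<And>b. b \<in> Basis \<Longrightarrow> has_bochner_integral lborel (f b) (c b)"
  shows "has_bochner_integral lborel (\<lambda>x. \<Prod>b\<in>Basis. f b (x \<bullet> b)) (\<Prod>b\<in>Basis. c b)"
proof -
  interpret product_sigma_finite "\<lambda>_::'a. lborel :: real measure" ..
  have int: "integrable lborel (f b)" if "b \<in> Basis" for b
    using f[OF that] by (simp add: has_bochner_integral_iff)
  have eq: "(\<Prod>b\<in>Basis. f b ((\<Sum>b\<in>Basis. x b *\<^sub>R b) \<bullet> b)) = (\<Prod>b\<in>Basis. f b (x b))" for x
    by (rule prod.cong) auto
  have m: "(\<lambda>f. \<Sum>b\<in>Basis. f b *\<^sub>R b) \<in> measurable (\<Pi>\<^sub>M b\<in>Basis. lborel) (borel :: 'a measure)"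
    by measurable
  have fm: "f b \<in> borel_measurable borel" if "b \<in> Basis" for b
    using borel_measurable_integrable[OF int[OF that]] by simp
  have fm: "(\<lambda>x. \<Prod>b\<in>Basis. f b (x \<bullet> b)) \<in> borel_measurable (borel :: 'a measure)"
    by (intro borel_measurable_prod measurable_compose[OF _ fm]) auto
  have L: "(lborel :: 'a measure) = distr (\<Pi>\<^sub>M b\<in>Basis. lborel) borel (\<lambda>f. \<Sum>b\<in>Basis. f b *\<^sub>R b)"
    by (rule lborel_eq)
  show ?thesis
    unfolding has_bochner_integral_iff
  proof
    show "integrable lborel (\<lambda>x. \<Prod>b\<in>Basis. f b (x \<bullet> b))"
      unfolding L using m fm
      by (subst integrable_distr_eq) (auto simp: eq intro!: product_integrable_prod int)
    have "(\<integral>x. (\<Prod>b\<in>Basis. f b (x \<bullet> b)) \<partial>lborel) = (\<Prod>b\<in>Basis. integral\<^sup>L lborel (f b))"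
      unfolding L using m fm
      by (subst integral_distr)
         (auto simp: eq intro!: product_integral_prod int)
    also have "\<dots> = (\<Prod>b\<in>Basis. c b)"
      using f by (intro prod.cong) (auto simp: has_bochner_integral_iff)
    finally show "(\<integral>x. (\<Prod>b\<in>Basis. f b (x \<bullet> b)) \<partial>lborel) = (\<Prod>b\<in>Basis. c b)" .
  qed
qed

lemma gauss_fourier:
  fixes x :: "'a::euclidean_space"
  assumes r: "0 < r"
  shows "has_bochner_integral lborel
      (\<lambda>\<xi>. exp (- \<i> * complex_of_real (x \<bullet> \<xi>)) * complex_of_real (gauss_weight r \<xi>))
      (complex_of_real (gauss_kernel r x))"
proof -
  have *: "exp (\<Sum>b\<in>Basis. f b) = (\<Prod>b\<in>Basis. exp (f b))" for f :: "'a \<Rightarrow> complex"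
    by (rule exp_sum) simp
  have nrm: "(norm y)\<^sup>2 = (\<Sum>b\<in>Basis. (y \<bullet> b)\<^sup>2)" for y :: 'a
    unfolding power2_norm_eq_inner by (subst euclidean_inner) (simp add: power2_eq_square)
  have "has_bochner_integral lborel
      (\<lambda>\<xi>::'a. \<Prod>b\<in>Basis. exp (- \<i> * complex_of_real ((x \<bullet> b) * (\<xi> \<bullet> b))) * complex_of_real (exp (- (\<xi> \<bullet> b / r)\<^sup>2 / 2)))
      (\<Prod>b\<in>(Basis::'a set). complex_of_real (sqrt (2 * pi) * r * exp (- (r * (x \<bullet> b))\<^sup>2 / 2)))"
    by (intro has_bochner_integral_lborel_prod gauss_fourier_real r)
  also have "(\<lambda>\<xi>::'a. \<Prod>b\<in>Basis. exp (- \<i> * complex_of_real ((x \<bullet> b) * (\<xi> \<bullet> b))) * complex_of_real (exp (- (\<xi> \<bullet> b / r)\<^sup>2 / 2))) =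
    (\<lambda>\<xi>. exp (- \<i> * complex_of_real (x \<bullet> \<xi>)) * complex_of_real (gauss_weight r \<xi>))"
  proof
    fix \<xi> :: 'a
    have "(\<Prod>b\<in>Basis. exp (- \<i> * complex_of_real ((x \<bullet> b) * (\<xi> \<bullet> b)))) = exp (- \<i> * complex_of_real (x \<bullet> \<xi>))"
      by (simp add: *[symmetric] euclidean_inner[of x \<xi>] sum_distrib_left sum_negf)
    moreover have "(\<Prod>b\<in>Basis. complex_of_real (exp (- (\<xi> \<bullet> b / r)\<^sup>2 / 2))) = complex_of_real (gauss_weight r \<xi>)"
      by (simp add: of_real_prod[symmetric] exp_sum[symmetric] gauss_weight_def power_divide nrm
            sum_divide_distrib sum_negf del: of_real_exp of_real_prod)
    ultimately show "(\<Prod>b\<in>Basis. exp (- \<i> * complex_of_real ((x \<bullet> b) * (\<xi> \<bullet> b))) * complex_of_real (exp (- (\<xi> \<bullet> b / r)\<^sup>2 / 2))) =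
      exp (- \<i> * complex_of_real (x \<bullet> \<xi>)) * complex_of_real (gauss_weight r \<xi>)"
      by (simp only: prod.distrib)
  qed
  also have "(\<Prod>b\<in>(Basis::'a set). complex_of_real (sqrt (2 * pi) * r * exp (- (r * (x \<bullet> b))\<^sup>2 / 2))) =
    complex_of_real (gauss_kernel r x)"
    by (simp add: of_real_prod[symmetric] prod.distrib exp_sum[symmetric] gauss_kernel_def power_mult_distrib nrm
            sum_divide_distrib sum_negf sum_distrib_left del: of_real_exp of_real_prod of_real_mult)
  finally show ?thesis .
qed

lemma integrable_gauss_weight:
  "0 < r \<Longrightarrow> integrable lborel (gauss_weight r :: 'a::euclidean_space \<Rightarrow> real)"
proof -
  assume "0 < r"
  then have "integrable lborel (\<lambda>\<xi>::'a. norm (exp (- \<i> * complex_of_real (0 \<bullet> \<xi>)) * complex_of_real (gauss_weight r \<xi>)))"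
    using gauss_fourier[of r "0::'a"] by (intro integrable_norm) (simp only: has_bochner_integral_iff)
  then show ?thesis
    by (simp add: less_imp_le[OF gauss_weight_pos])
qed

lemma gauss_weight_increases_to_1:
  fixes \<xi> :: "'a::euclidean_space"
  shows "incseq (\<lambda>n. gauss_weight (real (Suc n)) \<xi>)"
    and "(\<lambda>n. gauss_weight (real (Suc n)) \<xi>) \<longlonglongrightarrow> 1"
proof -
  show "incseq (\<lambda>n. gauss_weight (real (Suc n)) \<xi>)"
    by (auto intro!: incseq_SucI divide_left_mono power_mono simp: gauss_weight_def power_divide)
  have "(\<lambda>n. norm \<xi> / real (Suc n)) \<longlonglongrightarrow> 0"
    by (intro LIMSEQ_Suc lim_const_over_n)
  then have "(\<lambda>n. exp (- (norm \<xi> / real (Suc n))\<^sup>2 / 2)) \<longlonglongrightarrow> exp (- 0\<^sup>2 / 2)"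
    by (intro tendsto_intros) auto
  then show "(\<lambda>n. gauss_weight (real (Suc n)) \<xi>) \<longlonglongrightarrow> 1"
    by (simp add: gauss_weight_def)
qed

lemma nn_integral_eq_SUP_gauss_weight:
  fixes h :: "'a::euclidean_space \<Rightarrow> real"
  assumes [measurable]: "h \<in> borel_measurable borel" and h: "\<And>\<xi>. 0 \<le> h \<xi>"
  shows "incseq (\<lambda>n. \<integral>\<^sup>+\<xi>. ennreal (h \<xi> * gauss_weight (real (Suc n)) \<xi>) \<partial>lborel)"
    and "(\<integral>\<^sup>+\<xi>. ennreal (h \<xi>) \<partial>lborel) =
      (SUP n. \<integral>\<^sup>+\<xi>. ennreal (h \<xi> * gauss_weight (real (Suc n)) \<xi>) \<partial>lborel)"
proof -
  have inc: "incseq (\<lambda>n \<xi>. ennreal (h \<xi> * gauss_weight (real (Suc n)) \<xi>))"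
    using gauss_weight_increases_to_1(1) h
    by (auto simp: incseq_def le_fun_def intro!: ennreal_leI mult_left_mono)
  show "incseq (\<lambda>n. \<integral>\<^sup>+\<xi>. ennreal (h \<xi> * gauss_weight (real (Suc n)) \<xi>) \<partial>lborel)"
    using inc by (auto simp: incseq_def le_fun_def intro!: nn_integral_mono)
  have "(SUP n. ennreal (h \<xi> * gauss_weight (real (Suc n)) \<xi>)) = ennreal (h \<xi>)" for \<xi>
  proof (rule LIMSEQ_unique[OF LIMSEQ_SUP])
    show "incseq (\<lambda>n. ennreal (h \<xi> * gauss_weight (real (Suc n)) \<xi>))"
      using inc by (auto simp: incseq_def le_fun_def)
    have "(\<lambda>n. h \<xi> * gauss_weight (real (Suc n)) \<xi>) \<longlonglongrightarrow> h \<xi> * 1"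
      by (intro tendsto_intros gauss_weight_increases_to_1)
    then show "(\<lambda>n. ennreal (h \<xi> * gauss_weight (real (Suc n)) \<xi>)) \<longlonglongrightarrow> ennreal (h \<xi>)"
      by (intro tendsto_ennrealI) simp
  qed
  then have "(\<integral>\<^sup>+\<xi>. ennreal (h \<xi>) \<partial>lborel) =
      (\<integral>\<^sup>+\<xi>. (SUP n. ennreal (h \<xi> * gauss_weight (real (Suc n)) \<xi>)) \<partial>lborel)"
    by simp
  also have "\<dots> = (SUP n. \<integral>\<^sup>+\<xi>. ennreal (h \<xi> * gauss_weight (real (Suc n)) \<xi>) \<partial>lborel)"
    by (rule nn_integral_monotone_convergence_SUP[OF inc]) simp
  finally show "(\<integral>\<^sup>+\<xi>. ennreal (h \<xi>) \<partial>lborel) =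
      (SUP n. \<integral>\<^sup>+\<xi>. ennreal (h \<xi> * gauss_weight (real (Suc n)) \<xi>) \<partial>lborel)" .
qed

section \<open>Energies of superpositions of characters\<close>

lemma borel_measurable_cnj [measurable (raw)]:
  "f \<in> borel_measurable M \<Longrightarrow> (\<lambda>x. cnj (f x)) \<in> borel_measurable M"
  by (rule measurable_compose[where N=borel]) (auto intro!: borel_measurable_continuous_onI continuous_intros)

lemma has_bochner_integral_pair_mult:
  fixes f g :: "_ \<Rightarrow> complex"
  assumes M: "sigma_finite_measure M" and N: "sigma_finite_measure N"
    and f: "integrable M f" and g: "integrable N g"
  shows "has_bochner_integral (M \<Otimes>\<^sub>M N) (\<lambda>(x, y). f x * g y) ((\<integral>x. f x \<partial>M) * (\<integral>y. g y \<partial>N))"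
proof -
  interpret pair_sigma_finite M N
    using M N by (simp add: pair_sigma_finite_def)
  note [measurable] = borel_measurable_integrable[OF f] borel_measurable_integrable[OF g]
  have int: "integrable (M \<Otimes>\<^sub>M N) (\<lambda>(x, y). f x * g y)"
  proof (rule Fubini_integrable)
    show "(\<lambda>(x, y). f x * g y) \<in> borel_measurable (M \<Otimes>\<^sub>M N)"
      by measurable
    show "integrable M (\<lambda>x. \<integral>y. norm (case (x, y) of (x, y) \<Rightarrow> f x * g y) \<partial>N)"
      using f g by (simp add: norm_mult)
    show "AE x in M. integrable N (\<lambda>y. case (x, y) of (x, y) \<Rightarrow> f x * g y)"
      using g by simp
  qed
  moreover have "(\<integral>p. (case p of (x, y) \<Rightarrow> f x * g y) \<partial>(M \<Otimes>\<^sub>M N)) = (\<integral>x. f x \<partial>M) * (\<integral>y. g y \<partial>N)"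
    using integral_fst'[OF int] by simp
  ultimately show ?thesis
    by (simp add: has_bochner_integral_iff)
qed

text \<open>The Fourier transform of the push-forward under \<open>s\<close> of the complex measure with density \<open>\<phi>\<close>.
Keeping \<open>s\<close> and \<open>\<phi>\<close> separate makes the absolute value of the density available, and the
push-forward itself may be singular.\<close>

definition superposition :: "'b measure \<Rightarrow> ('b \<Rightarrow> 'a::euclidean_space) \<Rightarrow> ('b \<Rightarrow> complex) \<Rightarrow> 'a \<Rightarrow> complex"
  where "superposition N s \<phi> \<xi> = (\<integral>x. exp (- \<i> * complex_of_real (s x \<bullet> \<xi>)) * \<phi> x \<partial>N)"

definition energy :: "'b measure \<Rightarrow> ('b \<Rightarrow> 'a::euclidean_space) \<Rightarrow> ('b \<Rightarrow> complex) \<Rightarrow> ennreal"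
  where "energy N s \<phi> = (\<integral>\<^sup>+\<xi>. ennreal ((cmod (superposition N s \<phi> \<xi>))\<^sup>2) \<partial>lborel)"

lemma norm_exp_minus_ii [simp]: "cmod (exp (- (\<i> * complex_of_real t))) = 1"
  using norm_exp_i_times[of "-t"] by simp

lemma integrable_oscillation:
  fixes s :: "'b \<Rightarrow> 'a::euclidean_space"
  assumes "integrable N \<phi>" and [measurable]: "s \<in> borel_measurable N"
  shows "integrable N (\<lambda>x. exp (- \<i> * complex_of_real (s x \<bullet> \<xi>)) * \<phi> x)"
proof (rule Bochner_Integration.integrable_bound[OF assms(1)])
  note [measurable] = borel_measurable_integrable[OF assms(1)]
  show "(\<lambda>x. exp (- \<i> * complex_of_real (s x \<bullet> \<xi>)) * \<phi> x) \<in> borel_measurable N"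
    by measurable
qed (simp add: norm_mult)

lemma measurable_superposition:
  fixes s :: "'b \<Rightarrow> 'a::euclidean_space"
  assumes "sigma_finite_measure N" and [measurable]: "s \<in> borel_measurable N" "\<phi> \<in> borel_measurable N"
  shows "superposition N s \<phi> \<in> borel_measurable borel"
proof -
  interpret sigma_finite_measure N by fact
  show ?thesis
    unfolding superposition_def by measurable
qed

lemma superposition_mult_cnj:
  fixes s :: "'b \<Rightarrow> 'a::euclidean_space"
  assumes N: "sigma_finite_measure N" and \<phi>: "integrable N \<phi>" and s: "s \<in> borel_measurable N"
  shows "superposition N s \<phi> \<xi> * cnj (superposition N s \<phi> \<xi>) =
    (\<integral>(x, y). exp (- \<i> * complex_of_real ((s x - s y) \<bullet> \<xi>)) * (\<phi> x * cnj (\<phi> y)) \<partial>(N \<Otimes>\<^sub>M N))"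
proof -
  let ?f = "\<lambda>x. exp (- \<i> * complex_of_real (s x \<bullet> \<xi>)) * \<phi> x"
  have f: "integrable N ?f" by (rule integrable_oscillation[OF \<phi> s])
  then have cf: "integrable N (\<lambda>x. cnj (?f x))" by (simp only: complex_integrable_cnj)
  have "superposition N s \<phi> \<xi> * cnj (superposition N s \<phi> \<xi>) = (\<integral>x. ?f x \<partial>N) * (\<integral>x. cnj (?f x) \<partial>N)"
    unfolding superposition_def by (simp only: Bochner_Integration.integral_cnj)
  also have "\<dots> = (\<integral>(x, y). ?f x * cnj (?f y) \<partial>(N \<Otimes>\<^sub>M N))"
    using has_bochner_integral_pair_mult[OF N N f cf] by (simp only: has_bochner_integral_iff)
  also have "(\<lambda>(x, y). ?f x * cnj (?f y)) =
      (\<lambda>(x, y). exp (- \<i> * complex_of_real ((s x - s y) \<bullet> \<xi>)) * (\<phi> x * cnj (\<phi> y)))"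
    by (auto simp: fun_eq_iff exp_cnj exp_add[symmetric] exp_diff inner_diff_left algebra_simps exp_minus divide_inverse)
  finally show ?thesis .
qed

text \<open>Fubini turns the Gaussian-weighted energy into a double integral against a positive kernel; this
replaces Plancherel's theorem.\<close>

lemma regularised_energy:
  fixes s :: "'b \<Rightarrow> 'a::euclidean_space"
  assumes N: "sigma_finite_measure N" and \<phi>: "integrable N \<phi>" and s[measurable]: "s \<in> borel_measurable N"
    and r: "0 < r"
  shows "has_bochner_integral (N \<Otimes>\<^sub>M N) (\<lambda>(x, y). \<phi> x * cnj (\<phi> y) * complex_of_real (gauss_kernel r (s x - s y)))
      (complex_of_real (\<integral>\<xi>. (cmod (superposition N s \<phi> \<xi>))\<^sup>2 * gauss_weight r \<xi> \<partial>lborel))"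
    and "integrable lborel (\<lambda>\<xi>. (cmod (superposition N s \<phi> \<xi>))\<^sup>2 * gauss_weight r \<xi>)"
proof -
  interpret NN: pair_sigma_finite N N
    using N by (simp add: pair_sigma_finite_def)
  have NN: "sigma_finite_measure (N \<Otimes>\<^sub>M N)" by unfold_locales
  interpret L: pair_sigma_finite lborel "N \<Otimes>\<^sub>M N"
    using NN by (simp add: pair_sigma_finite_def lborel.sigma_finite_measure_axioms)
  note [measurable] = borel_measurable_integrable[OF \<phi>]
  let ?h = "\<lambda>(x, y). \<phi> x * cnj (\<phi> y)" and ?t = "\<lambda>(x, y). s x - s y"
  let ?e = "\<lambda>\<xi> p. exp (- \<i> * complex_of_real (?t p \<bullet> \<xi>)) * complex_of_real (gauss_weight r \<xi>)"
  have h: "integrable (N \<Otimes>\<^sub>M N) ?h"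
    using has_bochner_integral_pair_mult[OF N N \<phi>, of "\<lambda>y. cnj (\<phi> y)"] \<phi>
    by (simp add: has_bochner_integral_iff)
  have w: "integrable lborel (\<lambda>\<xi>::'a. complex_of_real (gauss_weight r \<xi>))"
    unfolding complex_of_real_integrable_eq by (rule integrable_gauss_weight[OF r])
  have whh: "integrable (lborel \<Otimes>\<^sub>M (N \<Otimes>\<^sub>M N)) (\<lambda>(\<xi>::'a, p). complex_of_real (gauss_weight r \<xi>) * ?h p)"
    using has_bochner_integral_pair_mult[OF lborel.sigma_finite_measure_axioms NN w h]
    by (simp only: has_bochner_integral_iff)
  have F: "integrable (lborel \<Otimes>\<^sub>M (N \<Otimes>\<^sub>M N)) (\<lambda>(\<xi>::'a, p). ?e \<xi> p * ?h p)"
  proof (rule Bochner_Integration.integrable_bound[OF whh])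
    show "(\<lambda>(\<xi>::'a, p). ?e \<xi> p * ?h p) \<in> borel_measurable (lborel \<Otimes>\<^sub>M (N \<Otimes>\<^sub>M N))"
      by measurable
  qed (auto simp: norm_mult)
  have inner: "(\<integral>p. ?e \<xi> p * ?h p \<partial>(N \<Otimes>\<^sub>M N)) =
      complex_of_real ((cmod (superposition N s \<phi> \<xi>))\<^sup>2 * gauss_weight r \<xi>)" for \<xi>
  proof -
    have "(\<integral>p. ?e \<xi> p * ?h p \<partial>(N \<Otimes>\<^sub>M N)) =
      (\<integral>p. complex_of_real (gauss_weight r \<xi>) * (exp (- \<i> * complex_of_real (?t p \<bullet> \<xi>)) * ?h p) \<partial>(N \<Otimes>\<^sub>M N))"
      by (simp only: mult_ac)
    also have "\<dots> = complex_of_real (gauss_weight r \<xi>) * (\<integral>p. exp (- \<i> * complex_of_real (?t p \<bullet> \<xi>)) * ?h p \<partial>(N \<Otimes>\<^sub>M N))"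
      by simp
    also have "(\<integral>p. exp (- \<i> * complex_of_real (?t p \<bullet> \<xi>)) * ?h p \<partial>(N \<Otimes>\<^sub>M N)) =
        superposition N s \<phi> \<xi> * cnj (superposition N s \<phi> \<xi>)"
      unfolding superposition_mult_cnj[OF N \<phi> s] by (simp add: case_prod_unfold)
    finally show ?thesis
      by (simp add: complex_norm_square[symmetric] mult.commute)
  qed
  have "integrable lborel (\<lambda>\<xi>. \<integral>p. ?e \<xi> p * ?h p \<partial>(N \<Otimes>\<^sub>M N))"
    using L.integrable_fst'[OF F] by simp
  then show int: "integrable lborel (\<lambda>\<xi>. (cmod (superposition N s \<phi> \<xi>))\<^sup>2 * gauss_weight r \<xi>)"
    unfolding inner complex_of_real_integrable_eq .
  have inner2: "(\<integral>\<xi>. ?e \<xi> p * ?h p \<partial>lborel) = ?h p * complex_of_real (gauss_kernel r (?t p))" for p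
    using gauss_fourier[OF r, of "?t p"] by (simp add: has_bochner_integral_iff)
  have "integrable (N \<Otimes>\<^sub>M N) (\<lambda>p. \<integral>\<xi>. ?e \<xi> p * ?h p \<partial>lborel)"
    using L.integrable_snd[of "\<lambda>\<xi> p. ?e \<xi> p * ?h p"] F by simp
  moreover have "(\<integral>p. (\<integral>\<xi>. ?e \<xi> p * ?h p \<partial>lborel) \<partial>(N \<Otimes>\<^sub>M N)) = (\<integral>\<xi>. (\<integral>p. ?e \<xi> p * ?h p \<partial>(N \<Otimes>\<^sub>M N)) \<partial>lborel)"
    using F by (intro L.Fubini_integral)
  moreover have "\<dots> = complex_of_real (\<integral>\<xi>. (cmod (superposition N s \<phi> \<xi>))\<^sup>2 * gauss_weight r \<xi> \<partial>lborel)"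
    unfolding inner by (rule integral_complex_of_real)
  ultimately have "has_bochner_integral (N \<Otimes>\<^sub>M N) (\<lambda>p. ?h p * complex_of_real (gauss_kernel r (?t p)))
      (complex_of_real (\<integral>\<xi>. (cmod (superposition N s \<phi> \<xi>))\<^sup>2 * gauss_weight r \<xi> \<partial>lborel))"
    unfolding inner2 by (simp add: has_bochner_integral_iff)
  then show "has_bochner_integral (N \<Otimes>\<^sub>M N) (\<lambda>(x, y). \<phi> x * cnj (\<phi> y) * complex_of_real (gauss_kernel r (s x - s y)))
      (complex_of_real (\<integral>\<xi>. (cmod (superposition N s \<phi> \<xi>))\<^sup>2 * gauss_weight r \<xi> \<partial>lborel))"
    by (simp add: case_prod_unfold)
qed

lemma regularised_energy_nonneg:
  fixes s :: "'b \<Rightarrow> 'a::euclidean_space" and \<psi> :: "'b \<Rightarrow> real"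
  assumes N: "sigma_finite_measure N" and \<psi>: "integrable N \<psi>" and s: "s \<in> borel_measurable N"
    and r: "0 < r"
  shows "has_bochner_integral (N \<Otimes>\<^sub>M N) (\<lambda>(x, y). \<psi> x * \<psi> y * gauss_kernel r (s x - s y))
      (\<integral>\<xi>. (cmod (superposition N s (\<lambda>x. complex_of_real (\<psi> x)) \<xi>))\<^sup>2 * gauss_weight r \<xi> \<partial>lborel)"
proof -
  have "integrable N (\<lambda>x. complex_of_real (\<psi> x))" using \<psi> by simp
  from regularised_energy(1)[OF N this s r]
  have "has_bochner_integral (N \<Otimes>\<^sub>M N) (\<lambda>p. complex_of_real (case p of (x, y) \<Rightarrow> \<psi> x * \<psi> y * gauss_kernel r (s x - s y)))
      (complex_of_real (\<integral>\<xi>. (cmod (superposition N s (\<lambda>x. complex_of_real (\<psi> x)) \<xi>))\<^sup>2 * gauss_weight r \<xi> \<partial>lborel))"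
    by (simp add: case_prod_unfold)
  then show ?thesis
    by (simp only: has_bochner_integral_iff complex_of_real_integrable_eq integral_complex_of_real of_real_eq_iff)
qed

text \<open>The kernel is positive, so the double integral of \<open>\<phi>\<close> is at most that of \<open>a = cmod \<phi>\<close>, and with
\<open>\<delta> = \<psi> - a\<close> the product \<open>\<psi> x * \<psi> y\<close> exceeds \<open>a x * a y + \<delta> x * \<delta> y\<close> by nonnegative cross terms.\<close>

lemma regularised_energy_majorant:
  fixes s :: "'b \<Rightarrow> 'a::euclidean_space" and \<psi> :: "'b \<Rightarrow> real" and \<phi> :: "'b \<Rightarrow> complex"
  assumes N: "sigma_finite_measure N" and \<psi>: "integrable N \<psi>" and \<phi>[measurable]: "\<phi> \<in> borel_measurable N"
    and s: "s \<in> borel_measurable N" and r: "0 < r" and le: "\<And>x. cmod (\<phi> x) \<le> \<psi> x"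
  shows "(\<integral>\<xi>. (cmod (superposition N s \<phi> \<xi>))\<^sup>2 * gauss_weight r \<xi> \<partial>lborel) +
      (\<integral>\<xi>. (cmod (superposition N s (\<lambda>x. complex_of_real (\<psi> x - cmod (\<phi> x))) \<xi>))\<^sup>2 * gauss_weight r \<xi> \<partial>lborel) \<le>
      (\<integral>\<xi>. (cmod (superposition N s (\<lambda>x. complex_of_real (\<psi> x)) \<xi>))\<^sup>2 * gauss_weight r \<xi> \<partial>lborel)"
    (is "?A + ?D \<le> ?B")
proof -
  have \<phi>i: "integrable N \<phi>"
    by (rule Bochner_Integration.integrable_bound[OF \<psi> \<phi>]) (auto intro!: AE_I2 order_trans[OF le abs_ge_self])
  define a where "a x = cmod (\<phi> x)" for x
  have a: "integrable N a" unfolding a_def using \<phi>i by simp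
  have \<delta>: "integrable N (\<lambda>x. \<psi> x - a x)" using \<psi> a by simp
  let ?K = "\<lambda>x y. gauss_kernel r (s x - s y)"
  note A = regularised_energy(1)[OF N \<phi>i s r]
  note a' = regularised_energy_nonneg[OF N a s r]
  note B = regularised_energy_nonneg[OF N \<psi> s r]
  note D = regularised_energy_nonneg[OF N \<delta> s r]
  have "?A \<le> norm (complex_of_real ?A)" by simp
  also have "complex_of_real ?A = (\<integral>(x, y). \<phi> x * cnj (\<phi> y) * complex_of_real (?K x y) \<partial>(N \<Otimes>\<^sub>M N))"
    using A by (simp only: has_bochner_integral_iff)
  also have "norm \<dots> \<le> (\<integral>p. norm (case p of (x, y) \<Rightarrow> \<phi> x * cnj (\<phi> y) * complex_of_real (?K x y)) \<partial>(N \<Otimes>\<^sub>M N))"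
    by (rule integral_norm_bound)
  also have "\<dots> = (\<integral>(x, y). a x * a y * ?K x y \<partial>(N \<Otimes>\<^sub>M N))"
    using r by (intro Bochner_Integration.integral_cong)
      (auto simp: norm_mult a_def abs_of_pos gauss_kernel_pos)
  finally have "?A + ?D \<le> (\<integral>(x, y). a x * a y * ?K x y \<partial>(N \<Otimes>\<^sub>M N)) +
      (\<integral>(x, y). (\<psi> x - a x) * (\<psi> y - a y) * ?K x y \<partial>(N \<Otimes>\<^sub>M N))"
    using D by (simp add: has_bochner_integral_iff a_def)
  also have "\<dots> = (\<integral>p. (case p of (x, y) \<Rightarrow> a x * a y * ?K x y) +
      (case p of (x, y) \<Rightarrow> (\<psi> x - a x) * (\<psi> y - a y) * ?K x y) \<partial>(N \<Otimes>\<^sub>M N))"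
    using a' D by (intro Bochner_Integration.integral_add[symmetric]) (simp_all only: has_bochner_integral_iff)
  also have "\<dots> \<le> (\<integral>(x, y). \<psi> x * \<psi> y * ?K x y \<partial>(N \<Otimes>\<^sub>M N))"
  proof (rule integral_mono)
    show "integrable (N \<Otimes>\<^sub>M N) (\<lambda>p. (case p of (x, y) \<Rightarrow> a x * a y * ?K x y) +
      (case p of (x, y) \<Rightarrow> (\<psi> x - a x) * (\<psi> y - a y) * ?K x y))"
      using a' D by (intro Bochner_Integration.integrable_add) (simp_all only: has_bochner_integral_iff)
    show "integrable (N \<Otimes>\<^sub>M N) (\<lambda>(x, y). \<psi> x * \<psi> y * ?K x y)"
      using B by (simp only: has_bochner_integral_iff)
    fix p :: "'b \<times> 'b"
    obtain x y where p: "p = (x, y)" by force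
    have "0 \<le> a x" "0 \<le> a y" "0 \<le> \<psi> x - a x" "0 \<le> \<psi> y - a y"
      using le by (simp_all add: a_def)
    then have "0 \<le> a x * (\<psi> y - a y) + a y * (\<psi> x - a x)" by simp
    then have "a x * a y + (\<psi> x - a x) * (\<psi> y - a y) \<le> \<psi> x * \<psi> y"
      by (simp add: algebra_simps)
    then have "(a x * a y + (\<psi> x - a x) * (\<psi> y - a y)) * ?K x y \<le> \<psi> x * \<psi> y * ?K x y"
      using gauss_kernel_pos[OF r] by (intro mult_right_mono) (auto intro: less_imp_le)
    then show "(case p of (x, y) \<Rightarrow> a x * a y * ?K x y) + (case p of (x, y) \<Rightarrow> (\<psi> x - a x) * (\<psi> y - a y) * ?K x y)
      \<le> (case p of (x, y) \<Rightarrow> \<psi> x * \<psi> y * ?K x y)"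
      by (simp add: p distrib_right)
  qed
  also have "\<dots> = ?B" using B by (simp only: has_bochner_integral_iff)
  finally show ?thesis .
qed

lemma energy_eq_SUP:
  fixes s :: "'b \<Rightarrow> 'a::euclidean_space"
  assumes N: "sigma_finite_measure N" and \<phi>: "integrable N \<phi>" and s: "s \<in> borel_measurable N"
  shows "incseq (\<lambda>n. ennreal (\<integral>\<xi>. (cmod (superposition N s \<phi> \<xi>))\<^sup>2 * gauss_weight (real (Suc n)) \<xi> \<partial>lborel))"
    and "energy N s \<phi> = (SUP n. ennreal (\<integral>\<xi>. (cmod (superposition N s \<phi> \<xi>))\<^sup>2 * gauss_weight (real (Suc n)) \<xi> \<partial>lborel))"
proof -
  have [measurable]: "superposition N s \<phi> \<in> borel_measurable borel"
    by (rule measurable_superposition[OF N s borel_measurable_integrable[OF \<phi>]])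
  have *: "ennreal (\<integral>\<xi>. (cmod (superposition N s \<phi> \<xi>))\<^sup>2 * gauss_weight (real (Suc n)) \<xi> \<partial>lborel) =
      (\<integral>\<^sup>+\<xi>. ennreal ((cmod (superposition N s \<phi> \<xi>))\<^sup>2 * gauss_weight (real (Suc n)) \<xi>) \<partial>lborel)" for n
    by (intro nn_integral_eq_integral[symmetric] regularised_energy[OF N \<phi> s] AE_I2
      mult_nonneg_nonneg less_imp_le[OF gauss_weight_pos]) auto
  have m: "(\<lambda>\<xi>. (cmod (superposition N s \<phi> \<xi>))\<^sup>2) \<in> borel_measurable borel" by measurable
  show "incseq (\<lambda>n. ennreal (\<integral>\<xi>. (cmod (superposition N s \<phi> \<xi>))\<^sup>2 * gauss_weight (real (Suc n)) \<xi> \<partial>lborel))"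
    unfolding * by (rule nn_integral_eq_SUP_gauss_weight[OF m]) simp
  show "energy N s \<phi> = (SUP n. ennreal (\<integral>\<xi>. (cmod (superposition N s \<phi> \<xi>))\<^sup>2 * gauss_weight (real (Suc n)) \<xi> \<partial>lborel))"
    unfolding * energy_def by (rule nn_integral_eq_SUP_gauss_weight[OF m]) simp
qed

text \<open>Passage to the limit in the previous inequality by monotone convergence.  The surplus term on the left
carries the equality case to the limit, where the kernel has degenerated to a point mass.\<close>

lemma energy_majorant:
  fixes s :: "'b \<Rightarrow> 'a::euclidean_space" and \<psi> :: "'b \<Rightarrow> real" and \<phi> :: "'b \<Rightarrow> complex"
  assumes N: "sigma_finite_measure N" and \<psi>: "integrable N \<psi>" and \<phi>[measurable]: "\<phi> \<in> borel_measurable N"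
    and s: "s \<in> borel_measurable N" and le: "\<And>x. cmod (\<phi> x) \<le> \<psi> x"
  shows "energy N s \<phi> + energy N s (\<lambda>x. complex_of_real (\<psi> x - cmod (\<phi> x)))
      \<le> energy N s (\<lambda>x. complex_of_real (\<psi> x))"
proof -
  have \<phi>i: "integrable N \<phi>"
    by (rule Bochner_Integration.integrable_bound[OF \<psi> \<phi>]) (auto intro!: AE_I2 order_trans[OF le abs_ge_self])
  have \<delta>: "integrable N (\<lambda>x. complex_of_real (\<psi> x - cmod (\<phi> x)))"
    using \<psi> \<phi>i by (simp only: complex_of_real_integrable_eq) simp
  have \<psi>': "integrable N (\<lambda>x. complex_of_real (\<psi> x))" using \<psi> by simp
  let ?A = "\<lambda>\<phi> n. (\<integral>\<xi>. (cmod (superposition N s \<phi> \<xi>))\<^sup>2 * gauss_weight (real (Suc n)) \<xi> \<partial>lborel)"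
  have "energy N s \<phi> + energy N s (\<lambda>x. complex_of_real (\<psi> x - cmod (\<phi> x))) =
      (SUP n. ennreal (?A \<phi> n) + ennreal (?A (\<lambda>x. complex_of_real (\<psi> x - cmod (\<phi> x))) n))"
    unfolding energy_eq_SUP(2)[OF N \<phi>i s] energy_eq_SUP(2)[OF N \<delta> s]
    by (rule ennreal_SUP_add[symmetric]) (rule energy_eq_SUP(1)[OF N _ s], fact)+
  also have "\<dots> \<le> (SUP n. ennreal (?A (\<lambda>x. complex_of_real (\<psi> x)) n))"
  proof (rule SUP_mono')
    fix n
    have pos: "0 \<le> ?A \<phi> n" for \<phi>
      by (intro Bochner_Integration.integral_nonneg mult_nonneg_nonneg) (auto intro: less_imp_le gauss_weight_pos)
    show "ennreal (?A \<phi> n) + ennreal (?A (\<lambda>x. complex_of_real (\<psi> x - cmod (\<phi> x))) n) \<le> ennreal (?A (\<lambda>x. complex_of_real (\<psi> x)) n)"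
      unfolding ennreal_plus[OF pos pos, symmetric]
      by (intro ennreal_leI regularised_energy_majorant[OF N \<psi> \<phi> s _ le]) simp
  qed
  also have "\<dots> = energy N s (\<lambda>x. complex_of_real (\<psi> x))"
    by (rule energy_eq_SUP(2)[OF N \<psi>' s, symmetric])
  finally show ?thesis .
qed

text \<open>A nonnegative density of zero energy has vanishing Gaussian-weighted energy, hence vanishing double
integral against a strictly positive kernel, hence vanishing total mass.\<close>

lemma AE_eq_0_if_energy_eq_0:
  fixes s :: "'b \<Rightarrow> 'a::euclidean_space" and \<delta> :: "'b \<Rightarrow> real"
  assumes N: "sigma_finite_measure N" and \<delta>: "integrable N \<delta>" and s[measurable]: "s \<in> borel_measurable N"
    and nn: "\<And>x. 0 \<le> \<delta> x" and 0: "energy N s (\<lambda>x. complex_of_real (\<delta> x)) = 0"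
  shows "AE x in N. \<delta> x = 0"
proof -
  let ?K = "\<lambda>x y. gauss_kernel 1 (s x - s y)"
  have \<delta>': "integrable N (\<lambda>x. complex_of_real (\<delta> x))" using \<delta> by simp
  have "ennreal (\<integral>\<xi>. (cmod (superposition N s (\<lambda>x. complex_of_real (\<delta> x)) \<xi>))\<^sup>2 * gauss_weight (real (Suc 0)) \<xi> \<partial>lborel)
      \<le> energy N s (\<lambda>x. complex_of_real (\<delta> x))"
    unfolding energy_eq_SUP(2)[OF N \<delta>' s] by (rule SUP_upper) simp
  then have "(\<integral>\<xi>. (cmod (superposition N s (\<lambda>x. complex_of_real (\<delta> x)) \<xi>))\<^sup>2 * gauss_weight 1 \<xi> \<partial>lborel) \<le> 0"
    unfolding 0 by (simp add: ennreal_eq_0_iff)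
  moreover have hb: "has_bochner_integral (N \<Otimes>\<^sub>M N) (\<lambda>(x, y). \<delta> x * \<delta> y * ?K x y)
      (\<integral>\<xi>. (cmod (superposition N s (\<lambda>x. complex_of_real (\<delta> x)) \<xi>))\<^sup>2 * gauss_weight 1 \<xi> \<partial>lborel)"
    by (rule regularised_energy_nonneg[OF N \<delta> s]) simp
  moreover have K: "0 < ?K x y" for x y by (rule gauss_kernel_pos) simp
  have nn': "0 \<le> \<delta> x * \<delta> y * ?K x y" for x y
    using nn K by (intro mult_nonneg_nonneg) (auto intro: less_imp_le)
  ultimately have "(\<integral>(x, y). \<delta> x * \<delta> y * ?K x y \<partial>(N \<Otimes>\<^sub>M N)) \<le> 0"
    by (simp add: has_bochner_integral_iff)
  moreover have "0 \<le> (\<integral>(x, y). \<delta> x * \<delta> y * ?K x y \<partial>(N \<Otimes>\<^sub>M N))"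
    using nn' by (intro Bochner_Integration.integral_nonneg) auto
  ultimately have "(\<integral>(x, y). \<delta> x * \<delta> y * ?K x y \<partial>(N \<Otimes>\<^sub>M N)) = 0" by linarith
  then have "AE p in N \<Otimes>\<^sub>M N. (case p of (x, y) \<Rightarrow> \<delta> x * \<delta> y * ?K x y) = 0"
    using hb nn' by (subst (asm) integral_nonneg_eq_0_iff_AE) (auto simp: has_bochner_integral_iff)
  then have "AE p in N \<Otimes>\<^sub>M N. (case p of (x, y) \<Rightarrow> complex_of_real (\<delta> x) * complex_of_real (\<delta> y)) = 0"
  proof eventually_elim
    fix p assume "(case p of (x, y) \<Rightarrow> \<delta> x * \<delta> y * ?K x y) = 0"
    then show "(case p of (x, y) \<Rightarrow> complex_of_real (\<delta> x) * complex_of_real (\<delta> y)) = 0"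
      using K[of "fst p" "snd p"] by (auto simp: case_prod_beta)
  qed
  then have "(\<integral>(x, y). complex_of_real (\<delta> x) * complex_of_real (\<delta> y) \<partial>(N \<Otimes>\<^sub>M N)) = 0"
    by (rule integral_eq_zero_AE)
  then have "(\<integral>x. complex_of_real (\<delta> x) \<partial>N) * (\<integral>x. complex_of_real (\<delta> x) \<partial>N) = 0"
    using has_bochner_integral_pair_mult[OF N N \<delta>' \<delta>'] by (simp only: has_bochner_integral_iff)
  then have "(\<integral>x. \<delta> x \<partial>N) = 0" by (simp add: integral_complex_of_real)
  then show ?thesis
    using \<delta> nn by (subst (asm) integral_nonneg_eq_0_iff_AE) auto
qed

lemma energy_majorant_eq:
  fixes s :: "'b \<Rightarrow> 'a::euclidean_space" and \<psi> :: "'b \<Rightarrow> real" and \<phi> :: "'b \<Rightarrow> complex"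
  assumes N: "sigma_finite_measure N" and \<psi>: "integrable N \<psi>" and \<phi>[measurable]: "\<phi> \<in> borel_measurable N"
    and s: "s \<in> borel_measurable N" and le: "\<And>x. cmod (\<phi> x) \<le> \<psi> x"
    and fin: "energy N s (\<lambda>x. complex_of_real (\<psi> x)) < \<infinity>"
    and ge: "energy N s (\<lambda>x. complex_of_real (\<psi> x)) \<le> energy N s \<phi>"
  shows "AE x in N. cmod (\<phi> x) = \<psi> x"
proof -
  let ?\<delta> = "\<lambda>x. \<psi> x - cmod (\<phi> x)"
  have \<phi>i: "integrable N \<phi>"
    by (rule Bochner_Integration.integrable_bound[OF \<psi> \<phi>]) (auto intro!: AE_I2 order_trans[OF le abs_ge_self])
  have "energy N s \<phi> + energy N s (\<lambda>x. complex_of_real (?\<delta> x)) \<le> energy N s \<phi>"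
    using energy_majorant[OF N \<psi> \<phi> s le] ge by (rule order_trans)
  moreover have "energy N s \<phi> < \<infinity>"
    using energy_majorant[OF N \<psi> \<phi> s le] fin
    by (meson le_iff_add order.strict_trans1 order_trans)
  ultimately have "energy N s (\<lambda>x. complex_of_real (?\<delta> x)) = 0"
    by (metis add.right_neutral ennreal_add_left_cancel_le infinity_ennreal_def less_irrefl le_zero_eq)
  then have "AE x in N. ?\<delta> x = 0"
    using \<psi> \<phi>i le by (intro AE_eq_0_if_energy_eq_0[OF N _ s]) auto
  then show ?thesis by eventually_elim simp
qed

section \<open>The twofold convolution of surface measure away from the origin\<close>

lemma gauss_kernel_real3:
  "gauss_kernel r (x :: real^3) = sqrt (2 * pi) ^ 3 * (r ^ 3 * exp (- (r * norm x)\<^sup>2 / 2))"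
  by (simp add: gauss_kernel_def power_mult_distrib)

text \<open>Away from the origin the exponential beats the factor \<open>r ^ 3\<close>, via \<open>r ^ 3 \<le> 1 + r ^ 4\<close> and the
quadratic Taylor bound at \<open>z = r\<^sup>2 / 32\<close>, where \<open>r ^ 4 = 1024 * z\<^sup>2\<close> is at most \<open>2048 * exp z\<close>.\<close>

lemma gauss_kernel_far_le:
  fixes x :: "real^3"
  assumes r: "0 < r" and x: "1/4 \<le> norm x"
  shows "gauss_kernel r x \<le> sqrt (2 * pi) ^ 3 * 2049"
proof -
  define z where "z = r\<^sup>2 / 32"
  have z: "0 \<le> z" by (simp add: z_def)
  have "(r / 4)\<^sup>2 \<le> (r * norm x)\<^sup>2"
    using r x by (intro power_mono) (auto simp: mult_left_mono)
  then have "r ^ 3 * exp (- (r * norm x)\<^sup>2 / 2) \<le> r ^ 3 * exp (- z)"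
    using r by (intro mult_left_mono) (auto simp: z_def power2_eq_square)
  also have "r ^ 3 \<le> 2049 * exp z"
  proof -
    have e: "1 + z + z\<^sup>2 / 2 \<le> exp z" by (rule exp_lower_Taylor_quadratic[OF z])
    have "r ^ 3 \<le> 1 + r ^ 4"
    proof (cases "r \<le> 1")
      case True
      then have "r ^ 3 \<le> 1" using r by (simp add: power_le_one)
      then show ?thesis using r by (meson add_increasing2 less_imp_le zero_less_power order_trans)
    next
      case False
      then have "r ^ 3 \<le> r ^ 4" by (intro power_increasing) auto
      then show ?thesis by simp
    qed
    also have "r ^ 4 = 1024 * z\<^sup>2" by (simp add: z_def power2_eq_square power4_eq_xxxx)
    also have "1 + 1024 * z\<^sup>2 \<le> 2049 * exp z" using e z zero_le_power2[of z] by linarith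
    finally show ?thesis .
  qed
  then have "r ^ 3 * exp (- z) \<le> 2049"
    by (simp add: exp_minus field_simps)
  finally show ?thesis
    unfolding gauss_kernel_real3 by (intro mult_left_mono) auto
qed

lemma nn_integral_exp_decay_le:
  fixes l :: real
  assumes l: "0 < l"
  shows "(\<integral>\<^sup>+t. ennreal (exp (- l * (1 + t))) * indicator {-1..1} t \<partial>lborel) \<le> ennreal (1 / l)"
proof -
  have "(\<integral>\<^sup>+t. ennreal (exp (- l * (1 + t))) * indicator {-1..1} t \<partial>lborel) =
      ennreal ((- exp (- l * (1 + 1)) / l) - (- exp (- l * (1 + (-1))) / l))"
    using l by (intro nn_integral_FTC_Icc) (auto intro!: derivative_eq_intros)
  also have "\<dots> \<le> ennreal (1 / l)"
    using l by (intro ennreal_leI) simp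
  finally show ?thesis .
qed

lemma nn_integral_gaussian:
  fixes \<sigma> \<mu> :: real
  assumes \<sigma>: "0 < \<sigma>"
  shows "(\<integral>\<^sup>+t. ennreal (exp (- (t - \<mu>)\<^sup>2 / (2 * \<sigma>\<^sup>2))) \<partial>lborel) = ennreal (sqrt (2 * pi) * \<sigma>)"
proof -
  have "(\<integral>\<^sup>+t. ennreal (exp (- (t - \<mu>)\<^sup>2 / (2 * \<sigma>\<^sup>2))) \<partial>lborel) =
      (\<integral>\<^sup>+t. ennreal (sqrt (2 * pi) * \<sigma>) * ennreal (normal_density \<mu> \<sigma> t) \<partial>lborel)"
    using \<sigma> by (intro nn_integral_cong)
      (simp add: normal_density_def ennreal_mult[symmetric] real_sqrt_mult)
  also have "\<dots> = ennreal (sqrt (2 * pi) * \<sigma>) * (\<integral>\<^sup>+t. ennreal (normal_density \<mu> \<sigma> t) \<partial>lborel)"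
    by (rule nn_integral_cmult) simp
  also have "(\<integral>\<^sup>+t. ennreal (normal_density \<mu> \<sigma> t) \<partial>lborel) = 1"
    using \<sigma> by (subst nn_integral_eq_integral) auto
  finally show ?thesis by simp
qed

lemma nn_integral_sphere_measure_const: "(\<integral>\<^sup>+x. c \<partial>sphere_measure) = c * ennreal (4 * pi)"
  by (simp add: emeasure_sphere_measure_space)

text \<open>Surface measure smoothed at scale \<open>1 / r\<close> is concentrated within \<open>1 / r\<close> of the sphere, with height of
order \<open>r\<close>.  For \<open>y\<close> of length \<open>n\<close> and direction \<open>e\<close>, the squared distance from \<open>y\<close> to \<open>- d\<close> is
\<open>(n - 1)\<^sup>2 + 2 * n * (1 + e \<bullet> d)\<close>, a function of the height \<open>e \<bullet> d\<close> alone, so the zonal bound reduces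
the integral to that of an exponential.  For \<open>n < 1/2\<close> the factor \<open>1 / n\<close> lost there is avoided,
because \<open>y\<close> is far from the sphere.\<close>

lemma sphere_gauss_kernel_le:
  fixes y :: "real^3"
  assumes r: "0 < r"
  shows "(\<integral>\<^sup>+d. ennreal (gauss_kernel r (y + d)) \<partial>sphere_measure) \<le>
    ennreal (sqrt (2 * pi) ^ 3 * 2049 * (4 * pi) + sqrt (2 * pi) ^ 3 * 96 * (r * exp (- (r * (norm y - 1))\<^sup>2 / 2)))"
proof (cases "norm y < 1/2")
  case True
  have "(\<integral>\<^sup>+d. ennreal (gauss_kernel r (y + d)) \<partial>sphere_measure) \<le>
      (\<integral>\<^sup>+d. ennreal (sqrt (2 * pi) ^ 3 * 2049) \<partial>sphere_measure)"
  proof (intro nn_integral_mono ennreal_leI gauss_kernel_far_le r)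
    fix d assume "d \<in> space sphere_measure"
    then have "norm d = 1" by simp
    then show "1/4 \<le> norm (y + d)"
      using True norm_diff_ineq[of d y] by (simp add: add.commute)
  qed
  also have "\<dots> = ennreal (sqrt (2 * pi) ^ 3 * 2049 * (4 * pi))"
    unfolding nn_integral_sphere_measure_const by (rule ennreal_mult[symmetric]) auto
  also have "\<dots> \<le> ennreal (sqrt (2 * pi) ^ 3 * 2049 * (4 * pi) + sqrt (2 * pi) ^ 3 * 96 * (r * exp (- (r * (norm y - 1))\<^sup>2 / 2)))"
    using r by (intro ennreal_leI) simp
  finally show ?thesis .
next
  case False
  define n where "n = norm y"
  have n: "1/2 \<le> n" using False by (simp add: n_def)
  define e where "e = y /\<^sub>R n"
  have e: "norm e = 1" proof -
    have "0 < n" using n by linarith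
    then show ?thesis by (simp add: e_def flip: n_def)
  qed
  define C where "C = sqrt (2 * pi) ^ 3 * r ^ 3 * exp (- (r * (n - 1))\<^sup>2 / 2)"
  have C: "0 \<le> C" using r by (simp add: C_def)
  have "(\<integral>\<^sup>+d. ennreal (gauss_kernel r (y + d)) \<partial>sphere_measure) =
      (\<integral>\<^sup>+d. ennreal C * ennreal (exp (- (r\<^sup>2 * n) * (1 + e \<bullet> d))) \<partial>sphere_measure)"
  proof (rule nn_integral_cong)
    fix d assume "d \<in> space sphere_measure"
    then have d: "d \<bullet> d = 1" by (simp add: dot_square_norm)
    have yd: "y \<bullet> d = n * (e \<bullet> d)" using n by (simp add: e_def)
    have yy: "y \<bullet> y = n\<^sup>2" by (simp add: n_def dot_square_norm)
    have "(norm (y + d))\<^sup>2 = (n - 1)\<^sup>2 + 2 * n * (1 + e \<bullet> d)"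
      unfolding power2_norm_eq_inner
      by (simp add: inner_add_left inner_add_right d yd yy inner_commute[of d y] power2_eq_square algebra_simps)
    then have "- (r * norm (y + d))\<^sup>2 / 2 = - (r * (n - 1))\<^sup>2 / 2 + - (r\<^sup>2 * n) * (1 + e \<bullet> d)"
      by (simp add: power_mult_distrib power2_eq_square field_simps)
    then have "gauss_kernel r (y + d) = C * exp (- (r\<^sup>2 * n) * (1 + e \<bullet> d))"
      unfolding gauss_kernel_real3 C_def by (simp only: exp_add mult_ac)
    then show "ennreal (gauss_kernel r (y + d)) = ennreal C * ennreal (exp (- (r\<^sup>2 * n) * (1 + e \<bullet> d)))"
      using C by (simp add: ennreal_mult)
  qed
  also have "\<dots> = ennreal C * (\<integral>\<^sup>+d. ennreal (exp (- (r\<^sup>2 * n) * (1 + e \<bullet> d))) \<partial>sphere_measure)"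
    by (rule nn_integral_cmult) measurable
  also have "\<dots> \<le> ennreal C * (48 * (\<integral>\<^sup>+t. ennreal (exp (- (r\<^sup>2 * n) * (1 + t))) * indicator {-1..1} t \<partial>lborel))"
    by (intro mult_left_mono nn_integral_sphere_zonal_le e) auto
  also have "\<dots> \<le> ennreal C * (48 * ennreal (1 / (r\<^sup>2 * n)))"
    using r n by (intro mult_left_mono nn_integral_exp_decay_le) auto
  also have "\<dots> = ennreal (C * (48 * (1 / (r\<^sup>2 * n))))"
  proof -
    have "0 \<le> 1 / (r\<^sup>2 * n)" using n by simp
    with C show ?thesis by (simp only: ennreal_mult ennreal_numeral mult_nonneg_nonneg zero_le_numeral)
  qed
  also have "\<dots> \<le> ennreal (sqrt (2 * pi) ^ 3 * 2049 * (4 * pi) + sqrt (2 * pi) ^ 3 * 96 * (r * exp (- (r * (n - 1))\<^sup>2 / 2)))"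
  proof (rule ennreal_leI)
    have "C * (48 * (1 / (r\<^sup>2 * n))) = sqrt (2 * pi) ^ 3 * 48 * (r * exp (- (r * (n - 1))\<^sup>2 / 2)) * (1 / n)"
      using r n by (simp add: C_def field_simps power2_eq_square power3_eq_cube)
    also have "\<dots> \<le> sqrt (2 * pi) ^ 3 * 48 * (r * exp (- (r * (n - 1))\<^sup>2 / 2)) * 2"
      using r n by (intro mult_left_mono) (auto simp: field_simps)
    also have "\<dots> \<le> sqrt (2 * pi) ^ 3 * 2049 * (4 * pi) + sqrt (2 * pi) ^ 3 * 96 * (r * exp (- (r * (n - 1))\<^sup>2 / 2))"
      by simp
    finally show "C * (48 * (1 / (r\<^sup>2 * n))) \<le> \<dots>" .
  qed
  finally show ?thesis by (simp add: n_def)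
qed

text \<open>The first summand is the far-field term of the smoothed surface measure, integrated over the sphere;
in the second, \<open>192 = 48 * 4\<close> combines the zonal constant with the width bound \<open>r * \<sigma> \<le> 4\<close>.\<close>

definition convolution_bound :: real
  where "convolution_bound = sqrt (2 * pi) ^ 3 * 2049 * (4 * pi) * (4 * pi) + sqrt (2 * pi) ^ 3 * 96 * (192 * sqrt (2 * pi))"

text \<open>The convolution of surface measure with itself has density \<open>2 * pi / norm x\<close> on the ball of radius
\<open>2\<close>, so it is bounded at any positive distance from the origin.  For the smoothed version, the previous lemma leaves a
Gaussian in \<open>m - 1\<close> with \<open>m = norm (x + c)\<close>; as \<open>m\<^sup>2 - 1\<close> is affine in the height \<open>e \<bullet> c\<close> and
\<open>(m + 1)\<^sup>2 \<le> 16\<close>, it is dominated by a Gaussian in that height of width of order \<open>1 / r\<close>.\<close>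

lemma sphere_sphere_gauss_kernel_le:
  fixes x :: "real^3"
  assumes r: "0 < r" and x: "1/2 \<le> norm x" "norm x \<le> 2"
  shows "(\<integral>\<^sup>+c. (\<integral>\<^sup>+d. ennreal (gauss_kernel r (x + c + d)) \<partial>sphere_measure) \<partial>sphere_measure)
    \<le> ennreal convolution_bound"
proof -
  define n where "n = norm x"
  have n: "1/2 \<le> n" "n \<le> 2" using x by (simp_all add: n_def)
  define e where "e = x /\<^sub>R n"
  have e: "norm e = 1" proof -
    have "0 < n" using n by linarith
    then show ?thesis by (simp add: e_def flip: n_def)
  qed
  define C where "C = sqrt (2 * pi) ^ 3 * 2049 * (4 * pi)"
  define D where "D = sqrt (2 * pi) ^ 3 * 96"
  have C: "0 \<le> C" and D: "0 \<le> D" by (simp_all add: C_def D_def)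
  define \<sigma> where "\<sigma> = 2 / (r * n)"
  have \<sigma>: "0 < \<sigma>" using r n by (simp add: \<sigma>_def)
  define h where "h t = ennreal (exp (- (t - (- n / 2))\<^sup>2 / (2 * \<sigma>\<^sup>2)))" for t
  have h[measurable]: "h \<in> borel_measurable borel" unfolding h_def by measurable
  have "(\<integral>\<^sup>+c. (\<integral>\<^sup>+d. ennreal (gauss_kernel r (x + c + d)) \<partial>sphere_measure) \<partial>sphere_measure) \<le>
      (\<integral>\<^sup>+c. ennreal C + ennreal (D * r) * h (e \<bullet> c) \<partial>sphere_measure)"
  proof (rule nn_integral_mono)
    fix c assume "c \<in> space sphere_measure"
    then have c: "norm c = 1" by simp
    define m where "m = norm (x + c)"
    have m: "0 \<le> m" "m \<le> 3"
      using norm_triangle_ineq[of x c] n c by (simp_all add: m_def n_def)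
    have xc: "x \<bullet> c = n * (e \<bullet> c)" using n by (simp add: e_def)
    have xx: "x \<bullet> x = n\<^sup>2" and cc: "c \<bullet> c = 1" using c by (simp_all add: n_def dot_square_norm)
    have "m\<^sup>2 - 1 = n\<^sup>2 + 2 * n * (e \<bullet> c)"
      unfolding m_def power2_norm_eq_inner
      by (simp add: inner_add_left inner_add_right xc xx cc inner_commute[of c x])
    then have "4 * n\<^sup>2 * (e \<bullet> c - (- n / 2))\<^sup>2 = (m\<^sup>2 - 1)\<^sup>2"
      by (simp add: power2_eq_square algebra_simps)
    also have "\<dots> = (m - 1)\<^sup>2 * (m + 1)\<^sup>2"
      by (simp add: power2_eq_square algebra_simps)
    also have "\<dots> \<le> (m - 1)\<^sup>2 * 4\<^sup>2"
      using m by (intro mult_left_mono power_mono) auto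
    finally have "n\<^sup>2 * (e \<bullet> c - (- n / 2))\<^sup>2 \<le> 4 * (m - 1)\<^sup>2" by simp
    then have "r\<^sup>2 * (n\<^sup>2 * (e \<bullet> c - (- n / 2))\<^sup>2) \<le> r\<^sup>2 * (4 * (m - 1)\<^sup>2)"
      by (intro mult_left_mono) auto
    moreover have "(e \<bullet> c - (- n / 2))\<^sup>2 / (2 * \<sigma>\<^sup>2) = r\<^sup>2 * (n\<^sup>2 * (e \<bullet> c - (- n / 2))\<^sup>2) / 8"
      using r n by (simp add: \<sigma>_def power_divide power_mult_distrib)
    ultimately have "- (r * (m - 1))\<^sup>2 / 2 \<le> - (e \<bullet> c - (- n / 2))\<^sup>2 / (2 * \<sigma>\<^sup>2)"
      by (simp add: power_mult_distrib)
    then have "D * (r * exp (- (r * (m - 1))\<^sup>2 / 2)) \<le> D * (r * exp (- (e \<bullet> c - (- n / 2))\<^sup>2 / (2 * \<sigma>\<^sup>2)))"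
      using r D by (intro mult_left_mono) auto
    then have "ennreal (C + D * (r * exp (- (r * (m - 1))\<^sup>2 / 2))) \<le>
        ennreal (C + D * (r * exp (- (e \<bullet> c - (- n / 2))\<^sup>2 / (2 * \<sigma>\<^sup>2))))"
      by (intro ennreal_leI) simp
    also have "\<dots> = ennreal C + ennreal (D * r) * h (e \<bullet> c)"
      unfolding h_def using C D r
      by (simp add: ennreal_plus[symmetric] ennreal_mult[symmetric] mult.assoc del: ennreal_plus)
    finally show "(\<integral>\<^sup>+d. ennreal (gauss_kernel r (x + c + d)) \<partial>sphere_measure) \<le> ennreal C + ennreal (D * r) * h (e \<bullet> c)"
      using sphere_gauss_kernel_le[OF r, of "x + c"] unfolding m_def C_def D_def by (rule order_trans[rotated])
  qed
  also have "\<dots> = (\<integral>\<^sup>+c. ennreal C \<partial>sphere_measure) + (\<integral>\<^sup>+c. ennreal (D * r) * h (e \<bullet> c) \<partial>sphere_measure)"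
    by (rule nn_integral_add) measurable
  also have "(\<integral>\<^sup>+c. ennreal C \<partial>sphere_measure) = ennreal (C * (4 * pi))"
    unfolding nn_integral_sphere_measure_const using C by (intro ennreal_mult[symmetric]) auto
  also have "(\<integral>\<^sup>+c. ennreal (D * r) * h (e \<bullet> c) \<partial>sphere_measure) = ennreal (D * r) * (\<integral>\<^sup>+c. h (e \<bullet> c) \<partial>sphere_measure)"
    by (rule nn_integral_cmult) measurable
  also have "(\<integral>\<^sup>+c. h (e \<bullet> c) \<partial>sphere_measure) \<le> 48 * (\<integral>\<^sup>+t. h t * indicator {-1..1} t \<partial>lborel)"
    by (rule nn_integral_sphere_zonal_le[OF h e])
  also have "(\<integral>\<^sup>+t. h t * indicator {-1..1} t \<partial>lborel) \<le> (\<integral>\<^sup>+t. h t \<partial>lborel)"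
    by (intro nn_integral_mono) (simp split: split_indicator)
  also have "(\<integral>\<^sup>+t. h t \<partial>lborel) = ennreal (sqrt (2 * pi) * \<sigma>)"
    unfolding h_def by (rule nn_integral_gaussian[OF \<sigma>])
  also have "ennreal (C * (4 * pi)) + ennreal (D * r) * (48 * ennreal (sqrt (2 * pi) * \<sigma>)) =
      ennreal (C * (4 * pi) + D * r * (48 * (sqrt (2 * pi) * \<sigma>)))"
    using C D r \<sigma> by (subst ennreal_plus) (simp_all add: ennreal_mult)
  also have "\<dots> \<le> ennreal convolution_bound"
  proof (rule ennreal_leI)
    have "r * \<sigma> \<le> 4" using r n by (simp add: \<sigma>_def field_simps)
    then have "D * (48 * sqrt (2 * pi)) * (r * \<sigma>) \<le> D * (48 * sqrt (2 * pi)) * 4"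
      using D by (intro mult_left_mono) auto
    then show "C * (4 * pi) + D * r * (48 * (sqrt (2 * pi) * \<sigma>)) \<le> convolution_bound"
      by (simp add: convolution_bound_def C_def D_def mult_ac)
  qed
  finally show ?thesis
    by (simp add: add_left_mono mult_left_mono)
qed

section \<open>Finiteness of the fourth power integral\<close>

lemma measurable_into_sphere_measure:
  "f \<in> measurable M sphere_measure \<Longrightarrow> f \<in> borel_measurable M"
proof -
  assume f: "f \<in> measurable M sphere_measure"
  have "(\<lambda>x. x) \<in> measurable sphere_measure borel" by (rule measurable_sphere_measureI) simp
  from measurable_compose[OF f this] show ?thesis .
qed

lemma sigma_finite_sphere_measure: "sigma_finite_measure sphere_measure"
  using finite_measure_sphere_measure by (simp add: finite_measure_def)

lemma nn_integral_sphere_measure_uminus: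
  assumes "g \<in> borel_measurable sphere_measure"
  shows "(\<integral>\<^sup>+x. g (- x) \<partial>sphere_measure) = (\<integral>\<^sup>+x. g x \<partial>sphere_measure)"
proof -
  have "(\<integral>\<^sup>+x. g x \<partial>sphere_measure) = (\<integral>\<^sup>+x. g x \<partial>distr sphere_measure sphere_measure uminus)"
    by (simp add: distr_sphere_measure_uminus)
  also have "\<dots> = (\<integral>\<^sup>+x. g (- x) \<partial>sphere_measure)"
    using assms by (intro nn_integral_distr) auto
  finally show ?thesis ..
qed

definition quad_integral :: "(real^3 \<Rightarrow> real^3 \<Rightarrow> real^3 \<Rightarrow> real^3 \<Rightarrow> ennreal) \<Rightarrow> ennreal"
  where "quad_integral \<phi> =
    (\<integral>\<^sup>+a. \<integral>\<^sup>+b. \<integral>\<^sup>+c. \<integral>\<^sup>+d. \<phi> a b c d \<partial>sphere_measure \<partial>sphere_measure \<partial>sphere_measure \<partial>sphere_measure)"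

abbreviation quad_measurable :: "(real^3 \<Rightarrow> real^3 \<Rightarrow> real^3 \<Rightarrow> real^3 \<Rightarrow> ennreal) \<Rightarrow> bool"
  where "quad_measurable \<phi> \<equiv> (\<lambda>(((a, b), c), d). \<phi> a b c d) \<in>
    borel_measurable (((sphere_measure \<Otimes>\<^sub>M sphere_measure) \<Otimes>\<^sub>M sphere_measure) \<Otimes>\<^sub>M sphere_measure)"

interpretation S: finite_measure sphere_measure
  by (rule finite_measure_sphere_measure)

interpretation SS: pair_sigma_finite sphere_measure sphere_measure ..

text \<open>Exchanging neighbours generates all permutations of the four variables.\<close>

lemma quad_integral_swaps:
  assumes \<phi>: "quad_measurable \<phi>"
  shows quad_integral_swap12: "quad_integral \<phi> = quad_integral (\<lambda>a b c d. \<phi> b a c d)"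
    and quad_integral_swap23: "quad_integral \<phi> = quad_integral (\<lambda>a b c d. \<phi> a c b d)"
    and quad_integral_swap34: "quad_integral \<phi> = quad_integral (\<lambda>a b c d. \<phi> a b d c)"
proof -
  have [measurable]: "(\<lambda>p. \<phi> (f p) (g p) (h p) (k p)) \<in> borel_measurable M"
    if [measurable]: "f \<in> measurable M sphere_measure" "g \<in> measurable M sphere_measure"
       "h \<in> measurable M sphere_measure" "k \<in> measurable M sphere_measure" for f g h k and M :: "'z measure"
  proof -
    have "(\<lambda>p. (((f p, g p), h p), k p)) \<in>
        measurable M (((sphere_measure \<Otimes>\<^sub>M sphere_measure) \<Otimes>\<^sub>M sphere_measure) \<Otimes>\<^sub>M sphere_measure)"
      by measurable
    from measurable_compose[OF this \<phi>] show ?thesis by simp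
  qed
  note m = this
  have c: "x \<in> space sphere_measure \<Longrightarrow> (\<lambda>_. x) \<in> measurable M sphere_measure" for x and M :: "'y measure"
    by (rule measurable_const)
  show "quad_integral \<phi> = quad_integral (\<lambda>a b c d. \<phi> b a c d)"
    unfolding quad_integral_def
    by (rule SS.Fubini') (unfold case_prod_unfold, intro S.borel_measurable_nn_integral, unfold case_prod_unfold,
        intro S.borel_measurable_nn_integral, unfold case_prod_unfold, intro m, measurable)
  show "quad_integral \<phi> = quad_integral (\<lambda>a b c d. \<phi> a c b d)"
    unfolding quad_integral_def
  proof (rule nn_integral_cong)
    fix a assume a: "a \<in> space sphere_measure"
    show "(\<integral>\<^sup>+b. \<integral>\<^sup>+c. \<integral>\<^sup>+d. \<phi> a b c d \<partial>sphere_measure \<partial>sphere_measure \<partial>sphere_measure) =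
        (\<integral>\<^sup>+b. \<integral>\<^sup>+c. \<integral>\<^sup>+d. \<phi> a c b d \<partial>sphere_measure \<partial>sphere_measure \<partial>sphere_measure)"
      by (rule SS.Fubini') (unfold case_prod_unfold, intro S.borel_measurable_nn_integral, unfold case_prod_unfold,
        intro m c[OF a], measurable)
  qed
  show "quad_integral \<phi> = quad_integral (\<lambda>a b c d. \<phi> a b d c)"
    unfolding quad_integral_def
  proof (rule nn_integral_cong, rule nn_integral_cong)
    fix a b assume a: "a \<in> space sphere_measure" and b: "b \<in> space sphere_measure"
    show "(\<integral>\<^sup>+c. \<integral>\<^sup>+d. \<phi> a b c d \<partial>sphere_measure \<partial>sphere_measure) =
        (\<integral>\<^sup>+c. \<integral>\<^sup>+d. \<phi> a b d c \<partial>sphere_measure \<partial>sphere_measure)"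
      by (rule SS.Fubini') (unfold case_prod_unfold, intro m c[OF a] c[OF b], measurable)
  qed
qed


lemma quad_integral_eq_product:
  assumes \<phi>: "quad_measurable \<phi>"
  shows "quad_integral \<phi> = (\<integral>\<^sup>+p. (case p of (((a, b), c), d) \<Rightarrow> \<phi> a b c d)
    \<partial>(((sphere_measure \<Otimes>\<^sub>M sphere_measure) \<Otimes>\<^sub>M sphere_measure) \<Otimes>\<^sub>M sphere_measure))"
proof -
  have m: "(\<lambda>p. case p of (((a, b), c), d) \<Rightarrow> \<phi> a b c d) \<in> borel_measurable
     (((sphere_measure \<Otimes>\<^sub>M sphere_measure) \<Otimes>\<^sub>M sphere_measure) \<Otimes>\<^sub>M sphere_measure)"
    using \<phi> by (simp add: case_prod_unfold)
  note m1 = S.borel_measurable_nn_integral_fst[OF m]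
  note m2 = S.borel_measurable_nn_integral_fst[OF m1]
  show ?thesis
    unfolding quad_integral_def S.nn_integral_fst[OF m, symmetric] S.nn_integral_fst[OF m1, symmetric]
      S.nn_integral_fst[OF m2, symmetric]
    by simp
qed

lemma quad_integral_add:
  assumes "quad_measurable \<phi>" "quad_measurable \<psi>"
  shows "quad_integral (\<lambda>a b c d. \<phi> a b c d + \<psi> a b c d) = quad_integral \<phi> + quad_integral \<psi>"
    and "quad_measurable (\<lambda>a b c d. \<phi> a b c d + \<psi> a b c d)"
proof -
  show m: "quad_measurable (\<lambda>a b c d. \<phi> a b c d + \<psi> a b c d)"
    using borel_measurable_add[OF assms] by (simp add: case_prod_unfold)
  show "quad_integral (\<lambda>a b c d. \<phi> a b c d + \<psi> a b c d) = quad_integral \<phi> + quad_integral \<psi>"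
    unfolding quad_integral_eq_product[OF m] quad_integral_eq_product[OF assms(1)] quad_integral_eq_product[OF assms(2)]
    using nn_integral_add[OF assms] by (simp add: case_prod_unfold)
qed

lemma quad_integral_mono:
  assumes "\<And>a b c d. norm a = 1 \<Longrightarrow> norm b = 1 \<Longrightarrow> norm c = 1 \<Longrightarrow> norm d = 1 \<Longrightarrow> \<phi> a b c d \<le> \<psi> a b c d"
  shows "quad_integral \<phi> \<le> quad_integral \<psi>"
  unfolding quad_integral_def by (intro nn_integral_mono assms) simp_all

text \<open>For unit vectors with sum \<open>S\<close>, the squared lengths of \<open>a + b\<close>, \<open>a + c\<close> and \<open>a + d\<close> add up to
\<open>4 + 2 * (a \<bullet> S)\<close>, so a small sum forces one of them to be at least \<open>1\<close>; the complementary
pair has nearly the opposite sum and is long too.  The bound \<open>3/4\<close> on the first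
length leaves \<open>1/2\<close> for the second.\<close>

lemma some_pair_not_antipodal:
  fixes a b c d :: "real^3"
  assumes "norm a = 1" "norm b = 1" "norm c = 1" "norm d = 1" and s: "norm (a + b + c + d) < 1/4"
  shows "1/2 \<le> norm (a + b) \<and> 1/2 \<le> norm (c + d) \<or>
    1/2 \<le> norm (a + c) \<and> 1/2 \<le> norm (b + d) \<or>
    1/2 \<le> norm (a + d) \<and> 1/2 \<le> norm (b + c)"
proof -
  have sq: "a \<bullet> a = 1" "b \<bullet> b = 1" "c \<bullet> c = 1" "d \<bullet> d = 1"
    using assms by (simp_all add: dot_square_norm)
  have "(norm (a + b))\<^sup>2 + (norm (a + c))\<^sup>2 + (norm (a + d))\<^sup>2 = 4 + 2 * (a \<bullet> (a + b + c + d))"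
    unfolding power2_norm_eq_inner by (simp add: inner_add_left inner_add_right sq inner_commute)
  moreover have "\<bar>a \<bullet> (a + b + c + d)\<bar> \<le> 1/4"
    using Cauchy_Schwarz_ineq2[of a "a + b + c + d"] assms by simp
  ultimately have sum: "3 \<le> (norm (a + b))\<^sup>2 + (norm (a + c))\<^sup>2 + (norm (a + d))\<^sup>2" by linarith
  have large: "3/4 \<le> norm x" if "1 \<le> (norm x)\<^sup>2" for x :: "real^3"
  proof -
    have "1 \<le> norm x" using that power2_le_imp_le[of 1 "norm x"] by simp
    then show ?thesis by simp
  qed
  have other: "1/2 \<le> norm y" if "3/4 \<le> norm x" "x + y = a + b + c + d" for x y :: "real^3"
    using that s norm_diff_ineq[of x y] by simp
  consider "1 \<le> (norm (a + b))\<^sup>2" | "1 \<le> (norm (a + c))\<^sup>2" | "1 \<le> (norm (a + d))\<^sup>2"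
    using sum by linarith
  then show ?thesis
  proof cases
    case 1
    from large[OF this] show ?thesis using other[of "a + b" "c + d"] by (simp add: add_ac)
  next
    case 2
    from large[OF this] show ?thesis using other[of "a + c" "b + d"] by (simp add: add_ac)
  next
    case 3
    from large[OF this] show ?thesis using other[of "a + d" "b + c"] by (simp add: add_ac)
  qed
qed

text \<open>The endpoint Tomas--Stein bound, in regularised form.  Where the sum of the four points is not small,
the kernel is bounded.  Elsewhere some pair and its complement both stay away from antipodal
position; the inequality \<open>x * y \<le> x\<^sup>2 + y\<^sup>2\<close>, applied to the products over the two pairs, leaves the square of \<open>u\<close>
on one pair only, and integrating the kernel over the other pair costs the bounded part of the
twofold convolution.  The six pairs contribute equally, by symmetry.\<close>

lemma quad_integral_gauss_kernel_bounded:
  fixes u :: "real^3 \<Rightarrow> real"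
  assumes u[measurable]: "u \<in> borel_measurable sphere_measure" and nn: "\<And>x. 0 \<le> u x"
    and fin: "(\<integral>\<^sup>+x. ennreal ((u x)\<^sup>2) \<partial>sphere_measure) < \<infinity>"
  obtains B where "B < \<infinity>"
    and "\<And>r. 0 < r \<Longrightarrow>
      quad_integral (\<lambda>a b c d. ennreal (u a * u b * u c * u d * gauss_kernel r (a + b + c + d))) \<le> B"
proof
  define I1 where "I1 = (\<integral>\<^sup>+x. ennreal (u x) \<partial>sphere_measure)"
  define I2 where "I2 = (\<integral>\<^sup>+x. ennreal ((u x)\<^sup>2) \<partial>sphere_measure)"
  define Ct where "Ct = sqrt (2 * pi) ^ 3 * 2049"
  define B where "B = ennreal Ct * (I1 * I1 * I1 * I1) + 6 * (ennreal convolution_bound * (I2 * I2))"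
  have Ct: "0 \<le> Ct" by (simp add: Ct_def)
  have "I1 \<le> (\<integral>\<^sup>+x. 1 + ennreal ((u x)\<^sup>2) \<partial>sphere_measure)"
    unfolding I1_def
  proof (rule nn_integral_mono)
    fix x
    have "u x \<le> 1 + (u x)\<^sup>2"
      using sum_squares_bound[of "u x" 1] nn[of x] zero_le_power2[of "u x"] by (simp add: power2_eq_square)
    then have "ennreal (u x) \<le> ennreal (1 + (u x)\<^sup>2)" by (rule ennreal_leI)
    then show "ennreal (u x) \<le> 1 + ennreal ((u x)\<^sup>2)" by (simp add: ennreal_plus[of 1])
  qed
  also have "\<dots> = (\<integral>\<^sup>+x. 1 \<partial>sphere_measure) + I2"
    unfolding I2_def by (rule nn_integral_add) measurable
  also have "\<dots> < \<infinity>"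
    using fin by (simp add: I2_def emeasure_sphere_measure_space)
  finally have I1: "I1 < \<infinity>" .
  show "B < \<infinity>"
    using I1 fin by (simp add: B_def I2_def[symmetric] ennreal_mult_less_top)
  fix r :: real assume r: "0 < r"
  define k where "k x = ennreal (gauss_kernel r x)" for x :: "real^3"
  have k[measurable]: "k \<in> borel_measurable borel" unfolding k_def by measurable
  define H where "H a b = ennreal (if 1/2 \<le> norm (a + b) then (u a * u b)\<^sup>2 else 0)" for a b :: "real^3"
  have Hm: "(\<lambda>p. H (f p) (g p)) \<in> borel_measurable M"
    if [measurable]: "f \<in> measurable M sphere_measure" "g \<in> measurable M sphere_measure" for f g and M :: "'z measure"
  proof -
    note [measurable] = measurable_into_sphere_measure[OF that(1)] measurable_into_sphere_measure[OF that(2)]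
    show ?thesis unfolding H_def by measurable
  qed
  have km: "(\<lambda>p. k (f p + g p + h p + l p)) \<in> borel_measurable M"
    if "f \<in> measurable M sphere_measure" "g \<in> measurable M sphere_measure"
       "h \<in> measurable M sphere_measure" "l \<in> measurable M sphere_measure" for f g h l and M :: "'z measure"
  proof -
    note [measurable] = that[THEN measurable_into_sphere_measure]
    show ?thesis by measurable
  qed
  have Um: "quad_measurable (\<lambda>a b c d. ennreal Ct * (ennreal (u a) * ennreal (u b) * ennreal (u c) * ennreal (u d)))"
    unfolding case_prod_unfold by measurable
  have m_ab: "quad_measurable (\<lambda>a b c d. H a b * k (a + b + c + d))"
    and m_ac: "quad_measurable (\<lambda>a b c d. H a c * k (a + b + c + d))"
    and m_ad: "quad_measurable (\<lambda>a b c d. H a d * k (a + b + c + d))"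
    and m_bc: "quad_measurable (\<lambda>a b c d. H b c * k (a + b + c + d))"
    and m_bd: "quad_measurable (\<lambda>a b c d. H b d * k (a + b + c + d))"
    and m_cd: "quad_measurable (\<lambda>a b c d. H c d * k (a + b + c + d))"
    by (unfold case_prod_unfold; intro borel_measurable_times_ennreal Hm km; measurable)+
  let ?Q = "quad_integral (\<lambda>a b c d. H a b * k (a + b + c + d))"
  have ac: "quad_integral (\<lambda>a b c d. H a c * k (a + b + c + d)) = ?Q"
    by (subst quad_integral_swap23[OF m_ac]) (simp add: add_ac)
  have ad: "quad_integral (\<lambda>a b c d. H a d * k (a + b + c + d)) = ?Q"
    by (subst quad_integral_swap34[OF m_ad]) (subst ac[symmetric], simp add: add_ac)
  have bc: "quad_integral (\<lambda>a b c d. H b c * k (a + b + c + d)) = ?Q"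
    by (subst quad_integral_swap12[OF m_bc]) (subst ac[symmetric], simp add: add_ac)
  have bd: "quad_integral (\<lambda>a b c d. H b d * k (a + b + c + d)) = ?Q"
    by (subst quad_integral_swap34[OF m_bd]) (subst bc[symmetric], simp add: add_ac)
  have cd: "quad_integral (\<lambda>a b c d. H c d * k (a + b + c + d)) = ?Q"
    by (subst quad_integral_swap23[OF m_cd]) (subst bd[symmetric], simp add: add_ac)
  have U4: "quad_integral (\<lambda>a b c d. ennreal Ct * (ennreal (u a) * ennreal (u b) * ennreal (u c) * ennreal (u d)))
      = ennreal Ct * (I1 * I1 * I1 * I1)"
    unfolding quad_integral_def I1_def
    by (simp add: nn_integral_cmult nn_integral_multc)
  have Q: "?Q \<le> ennreal convolution_bound * (I2 * I2)"
  proof -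
    have "?Q = (\<integral>\<^sup>+a. \<integral>\<^sup>+b. H a b * (\<integral>\<^sup>+c. \<integral>\<^sup>+d. k (a + b + c + d) \<partial>sphere_measure \<partial>sphere_measure) \<partial>sphere_measure \<partial>sphere_measure)"
      unfolding quad_integral_def
    proof (rule nn_integral_cong, rule nn_integral_cong)
      fix a b assume ab: "a \<in> space sphere_measure" "b \<in> space sphere_measure"
      have "(\<lambda>c. \<integral>\<^sup>+d. k (a + b + c + d) \<partial>sphere_measure) \<in> borel_measurable sphere_measure"
        by (rule S.borel_measurable_nn_integral, unfold case_prod_unfold, rule km)
           (use ab in \<open>auto intro: measurable_const\<close>)
      then have "(\<integral>\<^sup>+c. H a b * (\<integral>\<^sup>+d. k (a + b + c + d) \<partial>sphere_measure) \<partial>sphere_measure) =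
          H a b * (\<integral>\<^sup>+c. \<integral>\<^sup>+d. k (a + b + c + d) \<partial>sphere_measure \<partial>sphere_measure)"
        by (rule nn_integral_cmult)
      then show "(\<integral>\<^sup>+c. \<integral>\<^sup>+d. H a b * k (a + b + c + d) \<partial>sphere_measure \<partial>sphere_measure) =
          H a b * (\<integral>\<^sup>+c. \<integral>\<^sup>+d. k (a + b + c + d) \<partial>sphere_measure \<partial>sphere_measure)"
        by (simp add: nn_integral_cmult)
    qed
    also have "\<dots> \<le> (\<integral>\<^sup>+a. \<integral>\<^sup>+b. ennreal convolution_bound * (ennreal ((u a)\<^sup>2) * ennreal ((u b)\<^sup>2)) \<partial>sphere_measure \<partial>sphere_measure)"
    proof (rule nn_integral_mono, rule nn_integral_mono)
      fix a b assume "a \<in> space sphere_measure" "b \<in> space sphere_measure"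
      then have ab: "norm (a + b) \<le> 2" using norm_triangle_ineq[of a b] by simp
      show "H a b * (\<integral>\<^sup>+c. \<integral>\<^sup>+d. k (a + b + c + d) \<partial>sphere_measure \<partial>sphere_measure) \<le>
        ennreal convolution_bound * (ennreal ((u a)\<^sup>2) * ennreal ((u b)\<^sup>2))"
      proof (cases "1/2 \<le> norm (a + b)")
        case True
        have "H a b = ennreal ((u a)\<^sup>2) * ennreal ((u b)\<^sup>2)"
          using True by (simp add: H_def power_mult_distrib ennreal_mult)
        moreover have "(\<integral>\<^sup>+c. \<integral>\<^sup>+d. k (a + b + c + d) \<partial>sphere_measure \<partial>sphere_measure) \<le> ennreal convolution_bound"
          unfolding k_def by (rule sphere_sphere_gauss_kernel_le[OF r True ab])
        ultimately show ?thesis by (subst mult.commute) (simp add: mult_right_mono)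
      qed (simp add: H_def)
    qed
    also have "\<dots> = ennreal convolution_bound * (I2 * I2)"
      unfolding I2_def by (simp add: nn_integral_cmult nn_integral_multc)
    finally show ?thesis .
  qed
  note add = quad_integral_add
  have "quad_integral (\<lambda>a b c d. ennreal (u a * u b * u c * u d * gauss_kernel r (a + b + c + d))) \<le>
    quad_integral (\<lambda>a b c d. ennreal Ct * (ennreal (u a) * ennreal (u b) * ennreal (u c) * ennreal (u d))
      + (H a b * k (a + b + c + d) + (H c d * k (a + b + c + d)
      + (H a c * k (a + b + c + d) + (H b d * k (a + b + c + d)
      + (H a d * k (a + b + c + d) + H b c * k (a + b + c + d)))))))"
  proof (rule quad_integral_mono)
    fix a b c d :: "real^3" assume n: "norm a = 1" "norm b = 1" "norm c = 1" "norm d = 1"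
    define K where "K = gauss_kernel r (a + b + c + d)"
    have K: "0 \<le> K" unfolding K_def by (rule less_imp_le[OF gauss_kernel_pos[OF r]])
    define h where "h x y = (if 1/2 \<le> norm (x + y) then (u x * u y)\<^sup>2 else 0)" for x y
    have h: "0 \<le> h x y" for x y by (simp add: h_def)
    have "u a * u b * u c * u d * K \<le> Ct * (u a * u b * u c * u d) + (h a b + h c d + h a c + h b d + h a d + h b c) * K"
    proof (cases "1/4 \<le> norm (a + b + c + d)")
      case True
      then have "K \<le> Ct" unfolding K_def Ct_def by (rule gauss_kernel_far_le[OF r])
      then have "u a * u b * u c * u d * K \<le> u a * u b * u c * u d * Ct"
        using nn by (intro mult_left_mono) auto
      moreover have "0 \<le> (h a b + h c d + h a c + h b d + h a d + h b c) * K"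
        using h K by simp
      ultimately show ?thesis by (simp add: mult.commute)
    next
      case False
      have am: "x * y \<le> x\<^sup>2 + y\<^sup>2" for x y :: real
        using sum_squares_bound[of x y] zero_le_power2[of x] zero_le_power2[of y] by linarith
      have "u a * u b * u c * u d \<le> h a b + h c d + h a c + h b d + h a d + h b c"
      proof -
        consider "1/2 \<le> norm (a + b) \<and> 1/2 \<le> norm (c + d)" | "1/2 \<le> norm (a + c) \<and> 1/2 \<le> norm (b + d)"
            | "1/2 \<le> norm (a + d) \<and> 1/2 \<le> norm (b + c)"
          using some_pair_not_antipodal[OF n] False by auto
        then show ?thesis
        proof cases
          case 1
          then have "(u a * u b) * (u c * u d) \<le> h a b + h c d" unfolding h_def using am by simp
          then show ?thesis using h[of a c] h[of b d] h[of a d] h[of b c] by (simp add: mult_ac)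
        next
          case 2
          then have "(u a * u c) * (u b * u d) \<le> h a c + h b d" unfolding h_def using am by simp
          then show ?thesis using h[of a b] h[of c d] h[of a d] h[of b c] by (simp add: mult_ac)
        next
          case 3
          then have "(u a * u d) * (u b * u c) \<le> h a d + h b c" unfolding h_def using am by simp
          then show ?thesis using h[of a b] h[of c d] h[of a c] h[of b d] by (simp add: mult_ac)
        qed
      qed
      then have "u a * u b * u c * u d * K \<le> (h a b + h c d + h a c + h b d + h a d + h b c) * K"
        using K by (intro mult_right_mono)
      moreover have "0 \<le> Ct * (u a * u b * u c * u d)" using nn Ct by simp
      ultimately show ?thesis by linarith
    qed
    then have "ennreal (u a * u b * u c * u d * K) \<le>
      ennreal (Ct * (u a * u b * u c * u d) + (h a b * K + (h c d * K + (h a c * K + (h b d * K + (h a d * K + h b c * K))))))"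
      by (intro ennreal_leI) (simp add: algebra_simps)
    also have "\<dots> = ennreal Ct * (ennreal (u a) * ennreal (u b) * ennreal (u c) * ennreal (u d))
      + (H a b * ennreal K + (H c d * ennreal K
      + (H a c * ennreal K + (H b d * ennreal K
      + (H a d * ennreal K + H b c * ennreal K)))))"
      unfolding H_def h_def[symmetric] using nn Ct K h
      by (simp add: ennreal_plus[symmetric] ennreal_mult[symmetric] del: ennreal_plus)
    finally show "ennreal (u a * u b * u c * u d * gauss_kernel r (a + b + c + d)) \<le>
      ennreal Ct * (ennreal (u a) * ennreal (u b) * ennreal (u c) * ennreal (u d))
      + (H a b * k (a + b + c + d) + (H c d * k (a + b + c + d)
      + (H a c * k (a + b + c + d) + (H b d * k (a + b + c + d)
      + (H a d * k (a + b + c + d) + H b c * k (a + b + c + d))))))"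
      unfolding K_def k_def .
  qed
  also have "\<dots> = ennreal Ct * (I1 * I1 * I1 * I1) + (?Q + (?Q + (?Q + (?Q + (?Q + ?Q)))))"
    by (simp only: add Um m_ab m_ac m_ad m_bc m_bd m_cd U4 ac ad bc bd cd)
  also have "\<dots> = ennreal Ct * (I1 * I1 * I1 * I1) + 6 * ?Q"
  proof -
    have "q + (q + (q + (q + (q + q)))) = 6 * q" for q :: ennreal
    proof -
      have "6 * q = (1 + (1 + (1 + (1 + (1 + 1))))) * q" by simp
      then show ?thesis by (simp only: distrib_right mult_1_left)
    qed
    then show ?thesis by simp
  qed
  also have "\<dots> \<le> B"
    unfolding B_def by (intro add_left_mono mult_left_mono Q) simp
  finally show "quad_integral (\<lambda>a b c d. ennreal (u a * u b * u c * u d * gauss_kernel r (a + b + c + d))) \<le> B" .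
qed

text \<open>For even \<open>u\<close> the reflection of two of the four points replaces the difference of sums in the kernel by
the sum of all four points.\<close>

lemma energy_tensor_finite:
  fixes u :: "real^3 \<Rightarrow> real"
  assumes u[measurable]: "u \<in> borel_measurable sphere_measure" and nn: "\<And>x. 0 \<le> u x"
    and even: "\<And>x. u (- x) = u x"
    and int: "integrable sphere_measure u"
    and fin: "(\<integral>\<^sup>+x. ennreal ((u x)\<^sup>2) \<partial>sphere_measure) < \<infinity>"
  shows "integrable (sphere_measure \<Otimes>\<^sub>M sphere_measure) (\<lambda>(a, c). u a * u c)"
    and "energy (sphere_measure \<Otimes>\<^sub>M sphere_measure) (\<lambda>(a, c). a + c)
      (\<lambda>p. complex_of_real (case p of (a, c) \<Rightarrow> u a * u c)) < \<infinity>"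
proof -
  let ?N = "sphere_measure \<Otimes>\<^sub>M sphere_measure"
  let ?s = "\<lambda>(a, c). a + c :: real^3" and ?\<psi> = "\<lambda>(a, c). u a * u c"
  have N: "sigma_finite_measure ?N" by unfold_locales
  have "integrable sphere_measure (\<lambda>x. complex_of_real (u x))" using int by simp
  from has_bochner_integral_pair_mult[OF sigma_finite_sphere_measure sigma_finite_sphere_measure this this]
  have "integrable ?N (\<lambda>p. complex_of_real (?\<psi> p))"
    by (simp add: has_bochner_integral_iff case_prod_unfold)
  then show \<psi>: "integrable ?N ?\<psi>" by (simp only: complex_of_real_integrable_eq)
  have s[measurable]: "?s \<in> borel_measurable ?N"
    unfolding case_prod_unfold by (intro borel_measurable_add measurable_into_sphere_measure measurable_fst measurable_snd)
  obtain B :: ennreal where B: "B < \<infinity>" and le: "\<And>r. 0 < r \<Longrightarrow>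
      quad_integral (\<lambda>a b c d. ennreal (u a * u b * u c * u d * gauss_kernel r (a + b + c + d))) \<le> B"
    using quad_integral_gauss_kernel_bounded[OF u nn fin] by blast
  have "energy ?N ?s (\<lambda>p. complex_of_real (?\<psi> p)) \<le> B"
    unfolding energy_eq_SUP(2)[OF N \<open>integrable ?N (\<lambda>p. complex_of_real (?\<psi> p))\<close> s]
  proof (rule SUP_least)
    fix n :: nat
    define r where "r = real (Suc n)"
    have r: "0 < r" by (simp add: r_def)
    define K where "K = (\<lambda>x :: real^3. gauss_kernel r x)"
    have [measurable]: "K \<in> borel_measurable borel" unfolding K_def by (rule measurable_gauss_kernel)
    have K: "0 \<le> K x" for x unfolding K_def using gauss_kernel_pos[OF r] by (rule less_imp_le)
    let ?F = "\<lambda>(p, q). ?\<psi> p * ?\<psi> q * K (?s p - ?s q)"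
    have hb: "has_bochner_integral (?N \<Otimes>\<^sub>M ?N) ?F
      (\<integral>\<xi>. (cmod (superposition ?N ?s (\<lambda>p. complex_of_real (?\<psi> p)) \<xi>))\<^sup>2 * gauss_weight r \<xi> \<partial>lborel)"
      unfolding K_def by (rule regularised_energy_nonneg[OF N \<psi> s r])
    have Fm: "(\<lambda>x. ennreal (?F x)) \<in> borel_measurable (?N \<Otimes>\<^sub>M ?N)"
      using borel_measurable_integrable[of "?N \<Otimes>\<^sub>M ?N" ?F] hb by (simp add: has_bochner_integral_iff)
    have "ennreal (\<integral>\<xi>. (cmod (superposition ?N ?s (\<lambda>p. complex_of_real (?\<psi> p)) \<xi>))\<^sup>2 * gauss_weight r \<xi> \<partial>lborel)
        = (\<integral>\<^sup>+x. ennreal (?F x) \<partial>(?N \<Otimes>\<^sub>M ?N))"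
      using hb nn K by (subst nn_integral_eq_integral) (auto simp: has_bochner_integral_iff)
    also have "\<dots> = (\<integral>\<^sup>+p. (\<integral>\<^sup>+q. ennreal (?F (p, q)) \<partial>?N) \<partial>?N)"
      by (rule sigma_finite_measure.nn_integral_fst[OF N Fm, symmetric])
    also have "\<dots> = (\<integral>\<^sup>+a. (\<integral>\<^sup>+b. (\<integral>\<^sup>+q. ennreal (?F ((a, b), q)) \<partial>?N) \<partial>sphere_measure) \<partial>sphere_measure)"
      by (rule S.nn_integral_fst[OF sigma_finite_measure.borel_measurable_nn_integral_fst[OF N Fm], symmetric])
    also have "\<dots> = quad_integral (\<lambda>a b c d. ennreal (u a * u b * u c * u d * K (a + b + c + d)))"
      unfolding quad_integral_def
    proof (rule nn_integral_cong, rule nn_integral_cong)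
      fix a b assume ab: "a \<in> space sphere_measure" "b \<in> space sphere_measure"
      define g where "g c d = ennreal (u a * u b * u c * u d * K (a + b + c + d))" for c d
      have gm: "(\<lambda>p. g (f p) (h p)) \<in> borel_measurable M"
        if [measurable]: "f \<in> measurable M sphere_measure" "h \<in> measurable M sphere_measure" for f h and M :: "'z measure"
      proof -
        note [measurable] = that[THEN measurable_into_sphere_measure]
        show ?thesis unfolding g_def by measurable
      qed
      have gm': "(\<lambda>p. g (- fst p) (- snd p)) \<in> borel_measurable ?N"
        by (rule gm) measurable
      have "(\<integral>\<^sup>+q. ennreal (?F ((a, b), q)) \<partial>?N) = (\<integral>\<^sup>+q. g (- fst q) (- snd q) \<partial>?N)"
        by (intro nn_integral_cong) (auto simp: g_def even mult.assoc diff_diff_eq)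
      also have "\<dots> = (\<integral>\<^sup>+c. \<integral>\<^sup>+d. g (- c) (- d) \<partial>sphere_measure \<partial>sphere_measure)"
        using S.nn_integral_fst[OF gm'] by simp
      also have "\<dots> = (\<integral>\<^sup>+c. \<integral>\<^sup>+d. g (- c) d \<partial>sphere_measure \<partial>sphere_measure)"
      proof (rule nn_integral_cong)
        fix c assume c: "c \<in> space sphere_measure"
        show "(\<integral>\<^sup>+d. g (- c) (- d) \<partial>sphere_measure) = (\<integral>\<^sup>+d. g (- c) d \<partial>sphere_measure)"
          by (rule nn_integral_sphere_measure_uminus, rule gm) (use c in auto)
      qed
      also have "\<dots> = (\<integral>\<^sup>+c. \<integral>\<^sup>+d. g c d \<partial>sphere_measure \<partial>sphere_measure)"
      proof (rule nn_integral_sphere_measure_uminus[where g="\<lambda>c. \<integral>\<^sup>+d. g c d \<partial>sphere_measure"])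
        show "(\<lambda>c. \<integral>\<^sup>+d. g c d \<partial>sphere_measure) \<in> borel_measurable sphere_measure"
          by (rule S.borel_measurable_nn_integral, unfold case_prod_unfold, rule gm) auto
      qed
      finally show "(\<integral>\<^sup>+q. ennreal (?F ((a, b), q)) \<partial>?N) =
          (\<integral>\<^sup>+c. \<integral>\<^sup>+d. ennreal (u a * u b * u c * u d * K (a + b + c + d)) \<partial>sphere_measure \<partial>sphere_measure)"
        by (simp add: g_def)
    qed
    also have "\<dots> \<le> B" unfolding K_def by (rule le[OF r])
    finally show "ennreal (\<integral>\<xi>. (cmod (superposition ?N ?s (\<lambda>p. complex_of_real (?\<psi> p)) \<xi>))\<^sup>2 * gauss_weight (real (Suc n)) \<xi> \<partial>lborel) \<le> B"
      by (simp add: r_def)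
  qed
  with B show "energy ?N ?s (\<lambda>p. complex_of_real (?\<psi> p)) < \<infinity>"
    by (rule order.strict_trans1[rotated])
qed

section \<open>Extremizers\<close>

text \<open>The root is strictly increasing, and since an infinite integral has infinite norm rather than a default
value, the norms compare the integrals in that case too.\<close>

lemma Lp_norm_leD:
  assumes p: "0 < p" and le: "Lp_norm p M g \<le> Lp_norm p N h"
  shows "(\<integral>\<^sup>+x. ennreal (norm (g x) powr p) \<partial>M) \<le> (\<integral>\<^sup>+x. ennreal (norm (h x) powr p) \<partial>N)"
    (is "?I \<le> ?J")
proof (cases "?J = \<infinity>")
  case False
  with le have I: "?I \<noteq> \<infinity>"
    by (auto simp: Lp_norm_def Let_def top_unique split: if_splits)
  with False le have "enn2real ?I powr (1 / p) \<le> enn2real ?J powr (1 / p)"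
    by (simp add: Lp_norm_def Let_def)
  then have "(enn2real ?I powr (1 / p)) powr p \<le> (enn2real ?J powr (1 / p)) powr p"
    by (rule powr_mono2[rotated 2]) (use p in auto)
  moreover have "(x powr (1 / p)) powr p = x" if "0 \<le> x" for x :: real
    using that p by (simp add: powr_powr)
  ultimately have "enn2real ?I \<le> enn2real ?J"
    by (simp only: enn2real_nonneg)
  then show ?thesis
    using I False by (metis ennreal_enn2real_if ennreal_leI infinity_ennreal_def)
qed simp

lemma Lp_norm_cong:
  assumes "(\<integral>\<^sup>+x. ennreal (norm (g x) powr p) \<partial>M) = (\<integral>\<^sup>+x. ennreal (norm (h x) powr p) \<partial>N)"
  shows "Lp_norm p M g = Lp_norm p N h"
  unfolding Lp_norm_def assms ..

lemma Lp_norm_eq_0_imp_AE: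
  assumes [measurable]: "g \<in> borel_measurable M" and 0: "Lp_norm p M g = 0"
  shows "AE x in M. g x = 0"
proof -
  let ?I = "\<integral>\<^sup>+x. ennreal (norm (g x) powr p) \<partial>M"
  have "?I \<noteq> \<infinity>" "enn2real ?I = 0"
    using 0 by (auto simp: Lp_norm_def Let_def split: if_splits)
  then have "?I = 0" by (simp add: enn2real_eq_0_iff)
  then have "AE x in M. ennreal (norm (g x) powr p) = 0"
    by (subst (asm) nn_integral_0_iff_AE) auto
  then show ?thesis by eventually_elim simp
qed

lemma integral_sphere_measure_uminus:
  fixes g :: "real^3 \<Rightarrow> complex"
  assumes "g \<in> borel_measurable sphere_measure"
  shows "(\<integral>x. g (- x) \<partial>sphere_measure) = (\<integral>x. g x \<partial>sphere_measure)"
proof -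
  have "(\<integral>x. g x \<partial>sphere_measure) = (\<integral>x. g x \<partial>distr sphere_measure sphere_measure uminus)"
    by (simp add: distr_sphere_measure_uminus)
  also have "\<dots> = (\<integral>x. g (- x) \<partial>sphere_measure)"
    using assms by (intro integral_distr) auto
  finally show ?thesis ..
qed

lemma measurable_reflect:
  "g \<in> measurable sphere_measure M \<Longrightarrow> (\<lambda>x. g (- x)) \<in> measurable sphere_measure M"
  by (rule measurable_compose[OF uminus_measurable_sphere_measure])

lemma integrable_reflect:
  fixes g :: "real^3 \<Rightarrow> complex"
  assumes "integrable sphere_measure g"
  shows "integrable sphere_measure (\<lambda>x. g (- x))"
  using integrable_distr[of uminus sphere_measure sphere_measure g] assms
  by (simp add: distr_sphere_measure_uminus)

abbreviation sphere_pairs :: "((real^3) \<times> (real^3)) measure"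
  where "sphere_pairs \<equiv> sphere_measure \<Otimes>\<^sub>M sphere_measure"

text \<open>Its push-forward under addition is the convolution of \<open>f\<close> with its conjugate reflection, whose Fourier
transform is the squared modulus of that of \<open>f\<close>.  A convolution is unchanged when its two factors are
exchanged, so the density on the product may be symmetrised in \<open>a\<close> and \<open>c\<close>; this is the step that gains.\<close>

definition symmetrised_tensor :: "(real^3 \<Rightarrow> complex) \<Rightarrow> (real^3) \<times> (real^3) \<Rightarrow> complex"
  where "symmetrised_tensor f = (\<lambda>(a, c). (f a * cnj (f (- c)) + cnj (f (- a)) * f c) / 2)"

lemma superposition_symmetrised_tensor:
  assumes f: "integrable sphere_measure f"
  shows "superposition sphere_pairs (\<lambda>(a, c). a + c) (symmetrised_tensor f) \<xi> =
    complex_of_real ((cmod (sphere_fourier f \<xi>))\<^sup>2)"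
proof -
  have id: "(\<lambda>x. x) \<in> borel_measurable sphere_measure" by simp
  let ?e = "\<lambda>x. exp (- \<i> * complex_of_real (x \<bullet> \<xi>))"
  let ?g = "\<lambda>x. cnj (f (- x))"
  have g: "integrable sphere_measure ?g"
    using integrable_reflect[OF f] by simp
  have ef: "integrable sphere_measure (\<lambda>x. ?e x * f x)" and eg: "integrable sphere_measure (\<lambda>x. ?e x * ?g x)"
    by (rule integrable_oscillation[OF _ id], fact)+
  have F: "(\<integral>x. ?e x * f x \<partial>sphere_measure) = sphere_fourier f \<xi>"
    by (simp add: sphere_fourier_def)
  have G: "(\<integral>x. ?e x * ?g x \<partial>sphere_measure) = cnj (sphere_fourier f \<xi>)"
  proof -
    have "cnj (sphere_fourier f \<xi>) = (\<integral>x. cnj (?e x * f x) \<partial>sphere_measure)"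
      unfolding sphere_fourier_def by (rule Bochner_Integration.integral_cnj[symmetric])
    also have "\<dots> = (\<integral>x. cnj (?e (- x) * f (- x)) \<partial>sphere_measure)"
      using borel_measurable_integrable[OF ef]
      by (intro integral_sphere_measure_uminus[symmetric] borel_measurable_cnj)
    also have "\<dots> = (\<integral>x. ?e x * ?g x \<partial>sphere_measure)"
      by (simp add: exp_cnj)
    finally show ?thesis ..
  qed
  note fg = has_bochner_integral_pair_mult[OF sigma_finite_sphere_measure sigma_finite_sphere_measure ef eg, unfolded F G]
  note gf = has_bochner_integral_pair_mult[OF sigma_finite_sphere_measure sigma_finite_sphere_measure eg ef, unfolded F G]
  have "has_bochner_integral sphere_pairs
      (\<lambda>p. ((case p of (a, c) \<Rightarrow> ?e a * f a * (?e c * ?g c)) + (case p of (a, c) \<Rightarrow> ?e a * ?g a * (?e c * f c))) / 2)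
      ((sphere_fourier f \<xi> * cnj (sphere_fourier f \<xi>) + cnj (sphere_fourier f \<xi>) * sphere_fourier f \<xi>) / 2)"
    by (intro has_bochner_integral_divide_zero has_bochner_integral_add fg gf)
  also have "(\<lambda>p. ((case p of (a, c) \<Rightarrow> ?e a * f a * (?e c * ?g c)) + (case p of (a, c) \<Rightarrow> ?e a * ?g a * (?e c * f c))) / 2) =
      (\<lambda>p. exp (- \<i> * complex_of_real ((case p of (a, c) \<Rightarrow> a + c) \<bullet> \<xi>)) * symmetrised_tensor f p)"
  proof
    fix p :: "(real^3) \<times> (real^3)"
    obtain a c where p: "p = (a, c)" by force
    have "exp (- \<i> * complex_of_real ((a + c) \<bullet> \<xi>)) = ?e a * ?e c"
      by (simp add: inner_add_left exp_add[symmetric] algebra_simps)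
    then show "((case p of (a, c) \<Rightarrow> ?e a * f a * (?e c * ?g c)) + (case p of (a, c) \<Rightarrow> ?e a * ?g a * (?e c * f c))) / 2 =
      exp (- \<i> * complex_of_real ((case p of (a, c) \<Rightarrow> a + c) \<bullet> \<xi>)) * symmetrised_tensor f p"
      by (simp only: p prod.case symmetrised_tensor_def) (simp add: algebra_simps)
  qed
  also have "(sphere_fourier f \<xi> * cnj (sphere_fourier f \<xi>) + cnj (sphere_fourier f \<xi>) * sphere_fourier f \<xi>) / 2 =
      complex_of_real ((cmod (sphere_fourier f \<xi>))\<^sup>2)"
    by (simp add: mult.commute[of "cnj _"] flip: complex_norm_square)
  finally show ?thesis
    unfolding superposition_def by (simp only: has_bochner_integral_iff)
qed

lemma energy_symmetrised_tensor:
  assumes f: "integrable sphere_measure f"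
  shows "energy sphere_pairs (\<lambda>(a, c). a + c) (symmetrised_tensor f) =
    (\<integral>\<^sup>+\<xi>. ennreal (cmod (sphere_fourier f \<xi>) powr 4) \<partial>lborel)"
  unfolding energy_def superposition_symmetrised_tensor[OF f]
  by (simp add: norm_power power_mult[symmetric])

definition antipodal_mean :: "(real^3 \<Rightarrow> complex) \<Rightarrow> real^3 \<Rightarrow> real"
  where "antipodal_mean f x = sqrt (((cmod (f x))\<^sup>2 + (cmod (f (- x)))\<^sup>2) / 2)"

lemma antipodal_mean_nonneg: "0 \<le> antipodal_mean f x"
  and antipodal_mean_uminus: "antipodal_mean f (- x) = antipodal_mean f x"
  and antipodal_mean_sq: "(antipodal_mean f x)\<^sup>2 = ((cmod (f x))\<^sup>2 + (cmod (f (- x)))\<^sup>2) / 2"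
  by (simp_all add: antipodal_mean_def add.commute)

text \<open>The Cauchy--Schwarz inequality for the vectors \<open>(x, x')\<close> and \<open>(y', y)\<close> of moduli at \<open>a\<close>, \<open>- a\<close> and at
\<open>- c\<close>, \<open>c\<close>, in the form of Lagrange's identity.  Equality forces \<open>x * y = x' * y'\<close>.\<close>

lemma symmetrised_tensor_le:
  "cmod (symmetrised_tensor f (a, c)) \<le> antipodal_mean f a * antipodal_mean f c"
  and symmetrised_tensor_eqD:
  "cmod (symmetrised_tensor f (a, c)) = antipodal_mean f a * antipodal_mean f c \<Longrightarrow>
    cmod (f a) * cmod (f c) = cmod (f (- a)) * cmod (f (- c))"
proof -
  define x x' y y' where "x = cmod (f a)" and "x' = cmod (f (- a))" and "y = cmod (f c)" and "y' = cmod (f (- c))"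
  note defs = this
  define m where "m = antipodal_mean f a * antipodal_mean f c"
  have m: "0 \<le> m" "(2 * m)\<^sup>2 = (x * y' + x' * y)\<^sup>2 + (x * y - x' * y')\<^sup>2"
    by (simp_all add: m_def antipodal_mean_nonneg power_mult_distrib antipodal_mean_sq flip: defs)
       (simp add: power2_eq_square algebra_simps)
  have t: "cmod (symmetrised_tensor f (a, c)) \<le> (x * y' + x' * y) / 2"
    using norm_triangle_ineq[of "f a * cnj (f (- c))" "cnj (f (- a)) * f c"]
    by (simp add: symmetrised_tensor_def norm_divide norm_mult flip: defs)
  have le: "x * y' + x' * y \<le> 2 * m"
    by (rule power2_le_imp_le) (use m in auto)
  with t show "cmod (symmetrised_tensor f (a, c)) \<le> antipodal_mean f a * antipodal_mean f c"
    by (simp add: m_def)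
  assume "cmod (symmetrised_tensor f (a, c)) = antipodal_mean f a * antipodal_mean f c"
  with t le have "x * y' + x' * y = 2 * m" by (simp add: m_def)
  with m(2) have "(x * y - x' * y')\<^sup>2 = 0" by simp
  then show "cmod (f a) * cmod (f c) = cmod (f (- a)) * cmod (f (- c))"
    by (simp add: defs)
qed

lemma symmetrised_tensor_antipodal_mean:
  "symmetrised_tensor (\<lambda>x. complex_of_real (antipodal_mean f x)) p =
    complex_of_real (case p of (a, c) \<Rightarrow> antipodal_mean f a * antipodal_mean f c)"
  by (cases p) (simp add: symmetrised_tensor_def antipodal_mean_uminus)

theorem theorem1p3:
  fixes f :: "real^3 \<Rightarrow> complex"
  assumes "f \<in> Lp_space 2 sphere_measure"
    and "\<not> (AE x in sphere_measure. f x = 0)"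
    and "Lp_norm 4 lborel (sphere_fourier f) = sharp_const * Lp_norm 2 sphere_measure f"
  shows "AE x in sphere_measure. norm (f (- x)) = norm (f x)"
proof -
  let ?S = sphere_measure
  let ?u = "antipodal_mean f"
  let ?U = "\<lambda>x. complex_of_real (?u x)"
  let ?s = "\<lambda>(a, c). a + c :: real^3"
  have f[measurable]: "f \<in> borel_measurable ?S" and f_fin: "Lp_norm 2 ?S f < \<infinity>"
    using assms(1) by (auto simp: Lp_space_def)
  have f'[measurable]: "(\<lambda>x. f (- x)) \<in> borel_measurable ?S"
    by (rule measurable_reflect[OF f])
  have u[measurable]: "?u \<in> borel_measurable ?S"
    unfolding antipodal_mean_def by measurable
  have sq: "norm z powr 2 = (norm z)\<^sup>2" for z :: complex
    by (cases "z = 0") simp_all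
  have mass: "(\<integral>\<^sup>+x. ennreal ((?u x)\<^sup>2) \<partial>?S) = (\<integral>\<^sup>+x. ennreal ((cmod (f x))\<^sup>2) \<partial>?S)"
  proof -
    have "(\<integral>\<^sup>+x. ennreal ((?u x)\<^sup>2) \<partial>?S) =
        (\<integral>\<^sup>+x. ennreal (1/2) * (ennreal ((cmod (f x))\<^sup>2) + ennreal ((cmod (f (- x)))\<^sup>2)) \<partial>?S)"
    proof (rule nn_integral_cong)
      fix x
      have "ennreal (1/2) * (ennreal ((cmod (f x))\<^sup>2) + ennreal ((cmod (f (- x)))\<^sup>2)) =
          ennreal (1/2 * ((cmod (f x))\<^sup>2 + (cmod (f (- x)))\<^sup>2))"
        by (subst ennreal_plus[symmetric], simp, simp, subst ennreal_mult, simp_all)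
      then show "ennreal ((?u x)\<^sup>2) = ennreal (1/2) * (ennreal ((cmod (f x))\<^sup>2) + ennreal ((cmod (f (- x)))\<^sup>2))"
        unfolding antipodal_mean_sq by (simp only: mult.commute[of "1/2"] times_divide_eq_right mult_1_right)
    qed
    also have "\<dots> = ennreal (1/2) * ((\<integral>\<^sup>+x. ennreal ((cmod (f x))\<^sup>2) \<partial>?S) + (\<integral>\<^sup>+x. ennreal ((cmod (f (- x)))\<^sup>2) \<partial>?S))"
      by (simp add: nn_integral_cmult nn_integral_add)
    also have "(\<integral>\<^sup>+x. ennreal ((cmod (f (- x)))\<^sup>2) \<partial>?S) = (\<integral>\<^sup>+x. ennreal ((cmod (f x))\<^sup>2) \<partial>?S)"
      by (rule nn_integral_sphere_measure_uminus) measurable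
    also have "ennreal (1/2) * (I + I) = I" for I :: ennreal
    proof -
      have "ennreal (1/2) * (I + I) = (ennreal (1/2) + ennreal (1/2)) * I"
        by (simp only: distrib_left distrib_right)
      also have "ennreal (1/2) + ennreal (1/2) = 1" by (subst ennreal_plus[symmetric]) auto
      finally show ?thesis by simp
    qed
    finally show ?thesis .
  qed
  have U_norm: "Lp_norm 2 ?S ?U = Lp_norm 2 ?S f"
    by (rule Lp_norm_cong) (simp add: sq mass)
  have f2: "(\<integral>\<^sup>+x. ennreal ((cmod (f x))\<^sup>2) \<partial>?S) < \<infinity>"
    using f_fin by (auto simp: Lp_norm_def Let_def sq less_top split: if_splits)
  have square_integrable: "integrable ?S g"
    if [measurable]: "g \<in> borel_measurable ?S" and fin: "(\<integral>\<^sup>+x. ennreal ((cmod (g x))\<^sup>2) \<partial>?S) < \<infinity>" for g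
  proof -
    have "integrable ?S (\<lambda>x. (cmod (g x))\<^sup>2)"
      using fin by (intro integrableI_bounded) auto
    then have i: "integrable ?S (\<lambda>x. 1 + (cmod (g x))\<^sup>2)" by simp
    show ?thesis
    proof (rule Bochner_Integration.integrable_bound[OF i])
      show "AE x in ?S. norm (g x) \<le> norm (1 + (cmod (g x))\<^sup>2)"
      proof (rule AE_I2)
        fix x
        have "2 * cmod (g x) * 1 \<le> (cmod (g x))\<^sup>2 + 1"
          using sum_squares_bound[of "cmod (g x)" 1] by simp
        then have "cmod (g x) \<le> 1 + (cmod (g x))\<^sup>2" using norm_ge_zero[of "g x"] by linarith
        then show "norm (g x) \<le> norm (1 + (cmod (g x))\<^sup>2)" by simp
      qed
    qed measurable
  qed
  have fi: "integrable ?S f" by (rule square_integrable[OF f f2])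
  have Ui: "integrable ?S ?U"
    by (rule square_integrable) (use mass f2 in auto)
  have ui: "integrable ?S ?u" using Ui by (simp only: complex_of_real_integrable_eq)
  have norm_pos: "Lp_norm 2 ?S f \<noteq> 0"
    using Lp_norm_eq_0_imp_AE[OF f] assms(2) by blast
  \<comment> \<open>The antipodal mean has the same norm as \<open>f\<close>, so testing the supremum with it bounds its energy by
    that of \<open>f\<close>, whether or not the supremum is finite.\<close>
  have "Lp_norm 4 lborel (sphere_fourier ?U) / Lp_norm 2 ?S ?U \<le> sharp_const"
    unfolding sharp_const_def
  proof (rule SUP_upper)
    have "\<not> (AE x in ?S. ?U x = 0)"
    proof
      assume "AE x in ?S. ?U x = 0"
      then have "AE x in ?S. f x = 0"
      proof eventually_elim
        fix x assume "?U x = 0"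
        then have "(cmod (f x))\<^sup>2 + (cmod (f (- x)))\<^sup>2 = 0"
          using antipodal_mean_sq[of f x] by simp
        then show "f x = 0" by (simp add: add_nonneg_eq_0_iff)
      qed
      with assms(2) show False ..
    qed
    moreover have "?U \<in> Lp_space 2 ?S"
      using f_fin by (simp add: Lp_space_def U_norm)
    ultimately show "?U \<in> {g \<in> Lp_space 2 ?S. \<not> (AE x in ?S. g x = 0)}" by simp
  qed
  then have "Lp_norm 4 lborel (sphere_fourier ?U) / Lp_norm 2 ?S f * Lp_norm 2 ?S f \<le> sharp_const * Lp_norm 2 ?S f"
    unfolding U_norm by (intro mult_right_mono) auto
  then have "Lp_norm 4 lborel (sphere_fourier ?U) \<le> sharp_const * Lp_norm 2 ?S f"
    using norm_pos f_fin by (simp add: ennreal_divide_times)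
  then have le: "Lp_norm 4 lborel (sphere_fourier ?U) \<le> Lp_norm 4 lborel (sphere_fourier f)"
    by (simp add: assms(3))
  have eU: "energy sphere_pairs ?s (\<lambda>p. complex_of_real (case p of (a, c) \<Rightarrow> ?u a * ?u c)) =
      (\<integral>\<^sup>+\<xi>. ennreal (cmod (sphere_fourier ?U \<xi>) powr 4) \<partial>lborel)"
    using energy_symmetrised_tensor[OF Ui] unfolding symmetrised_tensor_antipodal_mean .
  note fin = energy_tensor_finite[OF u antipodal_mean_nonneg antipodal_mean_uminus ui]
  have "AE p in sphere_pairs. cmod (symmetrised_tensor f p) = (case p of (a, c) \<Rightarrow> ?u a * ?u c)"
  proof (rule energy_majorant_eq)
    show "sigma_finite_measure sphere_pairs" by unfold_locales
    show "integrable sphere_pairs (\<lambda>(a, c). ?u a * ?u c)"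
      by (rule fin(1)) (use mass f2 in simp)
    show "energy sphere_pairs ?s (\<lambda>p. complex_of_real (case p of (a, c) \<Rightarrow> ?u a * ?u c)) < \<infinity>"
      by (rule fin(2)) (use mass f2 in simp)
    show "symmetrised_tensor f \<in> borel_measurable sphere_pairs"
      unfolding symmetrised_tensor_def
      using measurable_compose[OF measurable_fst f'] measurable_compose[OF measurable_snd f']
      by measurable
    show "?s \<in> borel_measurable sphere_pairs"
      unfolding case_prod_unfold by (intro borel_measurable_add measurable_into_sphere_measure measurable_fst measurable_snd)
    show "cmod (symmetrised_tensor f p) \<le> (case p of (a, c) \<Rightarrow> ?u a * ?u c)" for p
      by (cases p) (simp add: symmetrised_tensor_le)
    show "energy sphere_pairs ?s (\<lambda>p. complex_of_real (case p of (a, c) \<Rightarrow> ?u a * ?u c))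
        \<le> energy sphere_pairs ?s (symmetrised_tensor f)"
      unfolding eU energy_symmetrised_tensor[OF fi] using le by (rule Lp_norm_leD[rotated]) simp
  qed
  then have "AE p in sphere_pairs. (case p of (a, c) \<Rightarrow> cmod (f a) * cmod (f c) = cmod (f (- a)) * cmod (f (- c)))"
    by eventually_elim (auto dest: symmetrised_tensor_eqD)
  then have ae: "AE a in ?S. AE c in ?S. cmod (f a) * cmod (f c) = cmod (f (- a)) * cmod (f (- c))"
    by (auto dest: SS.AE_pair)
  \<comment> \<open>Integrating the identity in \<open>c\<close> gives both sides the same positive factor.\<close>
  define m where "m = (\<integral>c. cmod (f c) \<partial>?S)"
  have m: "m \<noteq> 0"
  proof
    assume "m = 0"
    then have "AE x in ?S. cmod (f x) = 0"
      unfolding m_def using fi by (subst (asm) integral_nonneg_eq_0_iff_AE) auto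
    with assms(2) show False by simp
  qed
  have m': "(\<integral>c. cmod (f (- c)) \<partial>?S) = m"
  proof -
    have "(\<integral>c. complex_of_real (cmod (f (- c))) \<partial>?S) = (\<integral>c. complex_of_real (cmod (f c)) \<partial>?S)"
      by (rule integral_sphere_measure_uminus[of "\<lambda>c. complex_of_real (cmod (f c))"]) measurable
    then show ?thesis by (simp only: integral_complex_of_real of_real_eq_iff m_def)
  qed
  from ae show ?thesis
  proof eventually_elim
    fix a assume "AE c in ?S. cmod (f a) * cmod (f c) = cmod (f (- a)) * cmod (f (- c))"
    then have "(\<integral>c. cmod (f a) * cmod (f c) \<partial>?S) = (\<integral>c. cmod (f (- a)) * cmod (f (- c)) \<partial>?S)"
      by (rule integral_cong_AE[rotated 2]) measurable
    then have "cmod (f a) * m = cmod (f (- a)) * m"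
      using m' by (simp add: m_def)
    with m show "norm (f (- a)) = norm (f a)" by simp
  qed
qed

end
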